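(* Let $S$ be a non-densely defined regular symmetric operator in $\mathcal H$ with equal deficiency indices, let $U\in\mathbf B(\mathfrak N_i,\mathfrak N_{-i})$ be an admissible unitary operator, and let $\widetilde S$ be the corresponding selfadjoint extension of $S$, i.e., $$\operatorname{dom}\widetilde S=\operatorname{dom}S\dot+(I-U)\mathfrak N_i,\qquad \ker\big((U-V_i)\upharpoonright\mathfrak L_i\big)=\{0\},$$ $$\widetilde S(f_S+\varphi_i-U\varphi_i)=Sf_S+i\varphi_i+iU\varphi_i,\quad f_S\in\operatorname{dom}S,\ \varphi_i\in\mathfrak N_i.$$ Then: (1) the following equalities hold: $$\operatorname{dom}\widetilde S\cap\mathcal H_0=\operatorname{dom}S\dot+(I-U)\ker(P_{\mathfrak L_{-i}}U-V_iP_{\mathfrak L_i})$$ $$=\operatorname{dom}S\dot+(I-U^{-1})\ker(P_{\mathfrak L_i}U^{-1}-V_{-i}P_{\mathfrak L_{-i}})$$ $$=\operatorname{dom}S\dot+(I-P_{\mathfrak N'_{-i}}U)P_{\mathfrak N'_i}\ker(P_{\mathfrak L_{-i}}U-V_iP_{\mathfrak L_i})$$ $$=\operatorname{dom}S\dot+(I-P_{\mathfrak N'_i}U^{-1})P_{\mathfrak N'_{-i}}\ker(P_{\mathfrak L_i}U^{-1}-V_{-i}P_{\mathfrak L_{-i}});$$ (2) the subspaces $\mathfrak N'_i\ominus P_{\mathfrak N'_i}\ker(P_{\mathfrak L_{-i}}U-V_iP_{\mathfrak L_i})$ and $\mathfrak N'_{-i}\ominus P_{\mathfrak N'_{-i}}\ker(P_{\mathfrak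 L_i}U^{-1}-V_{-i}P_{\mathfrak L_{-i}})$ are the deficiency subspaces of $\widetilde S_0:=P_{\mathcal H_0}\widetilde S\upharpoonright(\operatorname{dom}\widetilde S\cap\mathcal H_0)$; (3) the following are equivalent: (i) the operator $\widetilde S_0$ is closed; (ii) the linear manifold $P_{\mathfrak N'_i}\ker(P_{\mathfrak L_{-i}}U-V_iP_{\mathfrak L_i})$ is a subspace; (iii) the linear manifold $P_{\mathfrak N'_{-i}}\ker(P_{\mathfrak L_i}U^{-1}-V_{-i}P_{\mathfrak L_{-i}})$ is a subspace; (4) the following are equivalent: (i) $\operatorname{dom}\widetilde S\cap\mathcal H_0=\operatorname{dom}S$; (ii) $\ker(P_{\mathfrak L_{-i}}U-V_iP_{\mathfrak L_i})=\{0\}$; (iii) $P_{\mathfrak N'_i}\ker(P_{\mathfrak L_{-i}}U-V_iP_{\mathfrak L_i})=\{0\}$; (iv) $\ker(P_{\mathfrak L_i}U^{-1}-V_{-i}P_{\mathfrak L_{-i}})=\{0\}$; (v) $P_{\mathfrak N'_{-i}}\ker(P_{\mathfrak L_i}U^{-1}-V_{-i}P_{\mathfrak L_{-i}})=\{0\}$; in particular, if one of the semi-deficiency subspaces of $S$ is trivial, then $\operatorname{dom}\widetilde S\cap\mathcal H_0=\operatorname{dom}S$; (5) in the case $n'_+=n'_-\neq0$ the following are equivalent: (i) the operator $\widetilde S_0$ is selfadjoint in $\mathcal H_0$; (ii) $P_{\mathfrak N'_i}\ker(P_{\mathfrak L_{-i}}U-V_iP_{\mathfrak L_i})=\mathfrak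 N'_i$ and $P_{\mathfrak N'_{-i}}U\ker(P_{\mathfrak L_{-i}}U-V_iP_{\mathfrak L_i})=\mathfrak N'_{-i}$; (iii) $P_{\mathfrak N'_{-i}}\ker(P_{\mathfrak L_i}U^{-1}-V_{-i}P_{\mathfrak L_{-i}})=\mathfrak N'_{-i}$ and $P_{\mathfrak N'_i}U^{-1}P_{\mathfrak N'_{-i}}\ker(P_{\mathfrak L_i}U^{-1}-V_{-i}P_{\mathfrak L_{-i}})=\mathfrak N'_i$; (iv) $P_{\mathfrak N'_i}\ker(P_{\mathfrak L_{-i}}U-V_iP_{\mathfrak L_i})=\mathfrak N'_i$ and $P_{\mathfrak N'_{-i}}\ker(P_{\mathfrak L_i}U^{-1}-V_{-i}P_{\mathfrak L_{-i}})=\mathfrak N'_{-i}$.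
   Context: $\mathcal H$ is an infinite-dimensional complex separable Hilbert space; "subspace" means closed linear manifold; $P_{\mathfrak K}$ is the orthogonal projection onto $\mathfrak K$; $\dot+$ is the direct sum of linear manifolds; $\mathbf B(H_1,H_2)$ is the space of bounded operators. $S$ is symmetric if $\operatorname{Im}(Sf,f)=0$ on $\operatorname{dom}S$. For a closed non-densely defined symmetric $S$: $\mathcal H_0=\overline{\operatorname{dom}}\,S$, $\mathfrak L=\mathcal H\ominus\mathcal H_0$, $S_0=P_{\mathcal H_0}S$ (an operator in $\mathcal H_0$ with domain $\operatorname{dom}S$); for $\lambda\in\mathbb C\setminus\mathbb R$, $\mathfrak N_\lambda=\mathcal H\ominus\operatorname{ran}(S-\bar\lambda I)$ (deficiency subspaces), $n_\pm=\dim\mathfrak N_\lambda$ for $\lambda\in\mathbb C_\pm$ (deficiency indices; $\mathbb C_\pm$ are the open upper/lower half-planes), $\mathfrak L_\lambda=P_{\mathfrak N_\lambda}\mathfrak L$, $\mathfrak N'_\lambda=\mathfrak N_\lambda\ominus\mathfrak L_\lambda$ (semi-deficiency subspaces; $\mathfrak N'_\lambda\subset\mathcal H_0$ is the deficiency subspace of $S_0$ in $\mathcal H_0$), $n'_\pm=\dim\mathfrak N'_\lambda$ for $\lambda\in\mathbb C_\pm$; $V_\lambda:\mathfrak L_\lambda\to\mathfrak L_{\bar\lambda}$ is the isometry $V_\lambda P_{\mathfrak N_\lambda}h=P_{\mathfrak N_{\bar\lambda}}h$, $h\in\mathfrak L$, so $V_{-i}=V_i^{-1}$. A closed symmetric $S$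 is called regular if $S_0$ is closed; equivalently, $\mathfrak L_\lambda$ is closed for one (hence all) non-real $\lambda$. A unitary $U$ from $\mathfrak N_i$ onto $\mathfrak N_{-i}$ is admissible if $(U-V_i)f\neq0$ for all $f\in\mathfrak L_i\setminus\{0\}$; the formulas for $\widetilde S$ in the claim give a bijection between admissible unitary $U$ and selfadjoint extensions of $S$ in $\mathcal H$.
   Formalization: The third and fourth equalities in (1) use (P_{N'_i} - P_{N'_{-i}}U)ker(...) and (P_{N'_{-i}} - P_{N'_i}U^{-1})ker(...), and (5)(iii) uses P_{N'_i}U^{-1}ker(...) = N'_i, without the inner projection; as printed these three are false. *)

theory Defs
  imports "HOL-Analysis.Analysis" "HOL-Library.Extended_Nat"
begin

(* A complex Hilbert space as a type class on top of the real one. The complex inner product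
   is linear in its first argument, and its real part is the underlying real inner product,
   so that norm, topology and completeness are the library's. *)
class complex_hilbert = real_inner + complete_space +
  fixes scaleC :: "complex \<Rightarrow> 'a \<Rightarrow> 'a" (infixr "*\<^sub>C" 75)
    and cinner :: "'a \<Rightarrow> 'a \<Rightarrow> complex"
  assumes scaleC_add_right: "a *\<^sub>C (x + y) = a *\<^sub>C x + a *\<^sub>C y"
    and scaleC_add_left: "(a + b) *\<^sub>C x = a *\<^sub>C x + b *\<^sub>C x"
    and scaleC_scaleC: "a *\<^sub>C (b *\<^sub>C x) = (a * b) *\<^sub>C x"
    and scaleR_eq_scaleC: "scaleR r x = complex_of_real r *\<^sub>C x"
    and cinner_commute: "cinner x y = cnj (cinner y x)"
    and cinner_add_left: "cinner (x + y) z = cinner x z + cinner y z"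
    and cinner_scaleC_left: "cinner (a *\<^sub>C x) y = a * cinner x y"
    and Re_cinner: "Re (cinner x y) = inner x y"

lemma scaleC_one: "1 *\<^sub>C x = (x :: 'a :: complex_hilbert)"
  using scaleR_eq_scaleC[of 1 x] by simp

global_interpretation complex_vector:
  vector_space "scaleC :: complex \<Rightarrow> 'a \<Rightarrow> 'a :: complex_hilbert"
  by unfold_locales (simp_all add: scaleC_add_right scaleC_add_left scaleC_scaleC scaleC_one)

abbreviation csubspace :: "'a :: complex_hilbert set \<Rightarrow> bool"
  where "csubspace \<equiv> complex_vector.subspace"

abbreviation cspan :: "'a :: complex_hilbert set \<Rightarrow> 'a set"
  where "cspan \<equiv> complex_vector.span"

(* The orthogonal sum H (+) H, in which the graphs of operators live. *)
instantiation prod :: (complex_hilbert, complex_hilbert) complex_hilbert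
begin

definition scaleC_prod :: "complex \<Rightarrow> 'a \<times> 'b \<Rightarrow> 'a \<times> 'b"
  where "scaleC_prod c p = (c *\<^sub>C fst p, c *\<^sub>C snd p)"

definition cinner_prod :: "'a \<times> 'b \<Rightarrow> 'a \<times> 'b \<Rightarrow> complex"
  where "cinner_prod p q = cinner (fst p) (fst q) + cinner (snd p) (snd q)"

instance
proof
  fix x y :: "'a \<times> 'b"
  show "cinner x y = cnj (cinner y x)"
    unfolding cinner_prod_def using cinner_commute[of "fst x"] cinner_commute[of "snd x"]
    by simp
qed (simp_all add: scaleC_prod_def cinner_prod_def scaleC_add_right scaleC_add_left
      scaleC_scaleC scaleR_prod_def scaleR_eq_scaleC cinner_add_left cinner_scaleC_left
      Re_cinner inner_prod_def algebra_simps)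

end

definition closed_csubspace :: "'a :: complex_hilbert set \<Rightarrow> bool"
  where "closed_csubspace V \<longleftrightarrow> csubspace V \<and> closed V"

definition ominus :: "'a :: complex_hilbert set \<Rightarrow> 'a set \<Rightarrow> 'a set" (infixl "\<ominus>" 65)
  where "A \<ominus> B = {x \<in> A. \<forall>y\<in>B. cinner x y = 0}"

(* Orthogonal projection onto a closed subspace K; unspecified for other K. *)
definition proj :: "'a :: complex_hilbert set \<Rightarrow> 'a \<Rightarrow> 'a"
  where "proj K x = (THE y. y \<in> K \<and> (\<forall>z\<in>K. cinner (x - y) z = 0))"

(* W is the direct sum of the linear manifolds A and B. *)
definition is_direct_sum :: "'a :: complex_hilbert set \<Rightarrow> 'a set \<Rightarrow> 'a set \<Rightarrow> bool"
  where "is_direct_sum W A B \<longleftrightarrow>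
    csubspace A \<and> csubspace B \<and> A \<inter> B = {0} \<and> W = {a + b | a b. a \<in> A \<and> b \<in> B}"

definition orthonormal_basis :: "'a :: complex_hilbert set \<Rightarrow> 'a set \<Rightarrow> bool"
  where "orthonormal_basis V B \<longleftrightarrow> B \<subseteq> V \<and> (\<forall>x\<in>B. norm x = 1) \<and>
    (\<forall>x\<in>B. \<forall>y\<in>B. x \<noteq> y \<longrightarrow> cinner x y = 0) \<and> V \<subseteq> closure (cspan B)"

(* Hilbert dimension of a closed subspace V. In a separable space orthonormal sets are
   countable, so that the only infinite value is aleph_0, rendered as infinity. *)
definition hdim :: "'a :: complex_hilbert set \<Rightarrow> enat"
  where "hdim V = (let B = SOME B. orthonormal_basis V B in if finite B then enat (card B) else \<infinity>)"

definition separable :: "'a :: topological_space itself \<Rightarrow> bool"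
  where "separable _ \<longleftrightarrow> (\<exists>A :: 'a set. countable A \<and> closure A = UNIV)"

(* Unbounded operators are given by their graphs: (f, g) \<in> T means f \<in> dom T and T f = g. *)
type_synonym 'a graph = "('a \<times> 'a) set"

definition linear_operator :: "'a :: complex_hilbert graph \<Rightarrow> bool"
  where "linear_operator T \<longleftrightarrow> csubspace T \<and> single_valued T"

definition closed_operator :: "'a :: complex_hilbert graph \<Rightarrow> bool"
  where "closed_operator T \<longleftrightarrow> linear_operator T \<and> closed T"

definition symmetric_operator :: "'a :: complex_hilbert graph \<Rightarrow> bool"
  where "symmetric_operator T \<longleftrightarrow> linear_operator T \<and> (\<forall>(f, g) \<in> T. Im (cinner g f) = 0)"

definition adjoint_in :: "'a :: complex_hilbert set \<Rightarrow> 'a graph \<Rightarrow> 'a graph"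
  where "adjoint_in K T = {(u, v). u \<in> K \<and> v \<in> K \<and> (\<forall>(f, g) \<in> T. cinner g u = cinner f v)}"

definition selfadjoint_in :: "'a :: complex_hilbert set \<Rightarrow> 'a graph \<Rightarrow> bool"
  where "selfadjoint_in K T \<longleftrightarrow>
    linear_operator T \<and> T \<subseteq> K \<times> K \<and> closure (Domain T) = K \<and> adjoint_in K T = T"

(* The operator P_K T restricted to (dom T) \<inter> K. *)
definition compression :: "'a :: complex_hilbert set \<Rightarrow> 'a graph \<Rightarrow> 'a graph"
  where "compression K T = {(f, proj K g) | f g. (f, g) \<in> T \<and> f \<in> K}"

(* K \<ominus> ran (T - cnj \<mu>), for an operator T in the subspace K. *)
definition deficiency_subspace :: "'a :: complex_hilbert set \<Rightarrow> 'a graph \<Rightarrow> complex \<Rightarrow> 'a set"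
  where "deficiency_subspace K T \<mu> = K \<ominus> {g - cnj \<mu> *\<^sub>C f | f g. (f, g) \<in> T}"

definition H0 :: "'a :: complex_hilbert graph \<Rightarrow> 'a set"
  where "H0 S = closure (Domain S)"

definition LL :: "'a :: complex_hilbert graph \<Rightarrow> 'a set"
  where "LL S = UNIV \<ominus> H0 S"

definition NN :: "'a :: complex_hilbert graph \<Rightarrow> complex \<Rightarrow> 'a set"
  where "NN S \<mu> = deficiency_subspace UNIV S \<mu>"

definition LL_at :: "'a :: complex_hilbert graph \<Rightarrow> complex \<Rightarrow> 'a set"
  where "LL_at S \<mu> = proj (NN S \<mu>) ` LL S"

definition NN' :: "'a :: complex_hilbert graph \<Rightarrow> complex \<Rightarrow> 'a set"
  where "NN' S \<mu> = NN S \<mu> \<ominus> LL_at S \<mu>"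

(* The vector h is unique because P_{NN S \<mu>} is injective on LL S for closed symmetric S
   and non-real \<mu>. *)
definition VV :: "'a :: complex_hilbert graph \<Rightarrow> complex \<Rightarrow> 'a \<Rightarrow> 'a"
  where "VV S \<mu> \<phi> = proj (NN S (cnj \<mu>)) (THE h. h \<in> LL S \<and> proj (NN S \<mu>) h = \<phi>)"

definition regular_symmetric :: "'a :: complex_hilbert graph \<Rightarrow> bool"
  where "regular_symmetric S \<longleftrightarrow>
    closed_operator S \<and> symmetric_operator S \<and> closed_operator (compression (H0 S) S)"

(* The (semi-)deficiency indices, computed at \<plusminus>\<i>; for closed (regular) symmetric S the
   dimensions of NN S \<mu> (of NN' S \<mu>) are constant on each open half-plane. *)
definition n_plus :: "'a :: complex_hilbert graph \<Rightarrow> enat"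
  where "n_plus S = hdim (NN S \<i>)"

definition n_minus :: "'a :: complex_hilbert graph \<Rightarrow> enat"
  where "n_minus S = hdim (NN S (-\<i>))"

definition n'_plus :: "'a :: complex_hilbert graph \<Rightarrow> enat"
  where "n'_plus S = hdim (NN' S \<i>)"

definition n'_minus :: "'a :: complex_hilbert graph \<Rightarrow> enat"
  where "n'_minus S = hdim (NN' S (-\<i>))"

(* Only the values of U on A matter. *)
definition unitary_onto :: "'a :: complex_hilbert set \<Rightarrow> 'a set \<Rightarrow> ('a \<Rightarrow> 'a) \<Rightarrow> bool"
  where "unitary_onto A B U \<longleftrightarrow>
    (\<forall>x\<in>A. \<forall>y\<in>A. U (x + y) = U x + U y) \<and> (\<forall>c. \<forall>x\<in>A. U (c *\<^sub>C x) = c *\<^sub>C U x) \<and>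
    (\<forall>x\<in>A. \<forall>y\<in>A. cinner (U x) (U y) = cinner x y) \<and> U ` A = B"

definition admissible :: "'a :: complex_hilbert graph \<Rightarrow> ('a \<Rightarrow> 'a) \<Rightarrow> bool"
  where "admissible S U \<longleftrightarrow> unitary_onto (NN S \<i>) (NN S (-\<i>)) U \<and>
    (\<forall>f \<in> LL_at S \<i> - {0}. U f - VV S \<i> f \<noteq> 0)"

definition U_inv :: "'a :: complex_hilbert graph \<Rightarrow> ('a \<Rightarrow> 'a) \<Rightarrow> 'a \<Rightarrow> 'a"
  where "U_inv S U = inv_into (NN S \<i>) U"

definition extension :: "'a :: complex_hilbert graph \<Rightarrow> ('a \<Rightarrow> 'a) \<Rightarrow> 'a graph"
  where "extension S U =
    {(f + \<phi> - U \<phi>, g + \<i> *\<^sub>C \<phi> + \<i> *\<^sub>C U \<phi>) | f g \<phi>. (f, g) \<in> S \<and> \<phi> \<in> NN S \<i>}"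

(* With \<mu> = \<i>, W = U this is ker (P_{L_{-i}} U - V_i P_{L_i}) in N_i; with \<mu> = -\<i>, W = U^{-1}
   it is ker (P_{L_i} U^{-1} - V_{-i} P_{L_{-i}}) in N_{-i}. *)
definition ker_at :: "'a :: complex_hilbert graph \<Rightarrow> complex \<Rightarrow> ('a \<Rightarrow> 'a) \<Rightarrow> 'a set"
  where "ker_at S \<mu> W =
    {\<phi> \<in> NN S \<mu>. proj (LL_at S (cnj \<mu>)) (W \<phi>) - VV S \<mu> (proj (LL_at S \<mu>) \<phi>) = 0}"

end

theory Submission
  imports Defs
begin

text \<open>Write \<^term>\<open>P\<close> and \<^term>\<open>Q\<close> for the projections onto the semi-deficiency subspaces at
  \<^term>\<open>\<i>\<close> and \<^term>\<open>- \<i>\<close>. For \<^term>\<open>h\<close> orthogonal to \<^term>\<open>Domain S\<close> the difference of its projections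
  onto the two deficiency subspaces lies in \<^term>\<open>Domain S\<close>, and both projections have the same
  norm. Hence the kernel in question is the set of all \<^term>\<open>\<phi>\<close> for which \<^term>\<open>\<phi> - U \<phi>\<close> lies in
  \<^term>\<open>H0 S\<close>, and the kernel for the inverse is its image under \<^term>\<open>U\<close>. Modulo \<^term>\<open>Domain S\<close>, the
  vector \<^term>\<open>\<phi> - U \<phi>\<close> equals \<^term>\<open>P \<phi> - Q (U \<phi>)\<close>, so that the compression of the extension is
  the von Neumann extension of the densely defined closed operator \<^term>\<open>compression (H0 S) S\<close> by
  the isometry that sends \<^term>\<open>P \<phi>\<close> to \<^term>\<open>Q (U \<phi>)\<close>. Everything is then read off from the ranges of
  this extension shifted by \<^term>\<open>\<i>\<close> and \<^term>\<open>- \<i>\<close>.\<close>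

subsection \<open>Complex Hilbert spaces\<close>

text \<open>The domain of \<open>S\<close> is not dense, so \<open>S\<close> has no adjoint operator
  and von Neumann's theory cannot be applied to it directly. Instead, membership in a deficiency
  subspace is used as a weak eigenvalue equation tested on the graph of \<open>S\<close>, and the
  extension theory is run in \<open>H0 S\<close>. Regularity serves twice: it makes the compressed
  operator closed, and it makes the spaces \<open>LL_at\<close> closed, so that the projections onto
  them are genuine. The kernel condition says that the \<open>LL_at\<close> parts of
  \<open>\<phi>\<close> and \<open>U \<phi>\<close> are projections of one vector of
  \<open>LL S\<close>; hence these parts cancel modulo \<open>Domain S\<close>, and dropping them
  keeps the norms equal. Each of the two shifts of the extension sees only the domain or only the
  range of the isometry, so closedness, deficiency and selfadjointness become properties of these
  two spaces. Admissibility makes the sums direct and \<open>P\<close> injective on the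
  kernel.\<close>

lemma cinner_add_right: "cinner x (y + z) = cinner x y + cinner x z"
  for x :: "'a :: complex_hilbert"
  using cinner_commute[of x "y + z"] cinner_commute[of x y] cinner_commute[of x z]
  by (simp add: cinner_add_left)

lemma cinner_scaleC_right: "cinner x (c *\<^sub>C y) = cnj c * cinner x y"
  for x :: "'a :: complex_hilbert"
  using cinner_commute[of x "c *\<^sub>C y"] cinner_commute[of x y] by (simp add: cinner_scaleC_left)

lemma cinner_zero [simp]: "cinner 0 x = 0" "cinner x 0 = 0" for x :: "'a :: complex_hilbert"
  using cinner_scaleC_left[of 0 x x] cinner_scaleC_right[of x 0 x] by simp_all

lemma cinner_minus [simp]: "cinner (- x) y = - cinner x y" "cinner x (- y) = - cinner x y"
  for x :: "'a :: complex_hilbert"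
  using cinner_scaleC_left[of "-1" x y] cinner_scaleC_right[of x "-1" y]
  by (simp_all add: complex_vector.scale_minus_left)

lemma cinner_diff_left: "cinner (x - y) z = cinner x z - cinner y z"
  for x :: "'a :: complex_hilbert"
  using cinner_add_left[of x "- y" z] by simp

lemma cinner_diff_right: "cinner x (y - z) = cinner x y - cinner x z"
  for x :: "'a :: complex_hilbert"
  using cinner_add_right[of x y "- z"] by simp

lemmas cinner_simps = cinner_add_left cinner_add_right cinner_diff_left cinner_diff_right
  cinner_scaleC_left cinner_scaleC_right

lemma cinner_eq_0_commute: "cinner x y = 0 \<longleftrightarrow> cinner y x = 0" for x :: "'a :: complex_hilbert"
  by (metis cinner_commute complex_cnj_zero)

lemma cinner_self: "cinner x x = complex_of_real ((norm x)\<^sup>2)" for x :: "'a :: complex_hilbert"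
proof (rule complex_eqI)
  have "Im (cinner x x) = - Im (cinner x x)"
    using cinner_commute[of x x] by (metis cnj.simps(2))
  then show "Im (cinner x x) = Im (complex_of_real ((norm x)\<^sup>2))" by simp
qed (simp add: Re_cinner power2_norm_eq_inner)

lemma cinner_self_eq_0 [simp]: "cinner x x = 0 \<longleftrightarrow> x = 0" for x :: "'a :: complex_hilbert"
  by (simp add: cinner_self)

lemma norm_scaleC: "norm (c *\<^sub>C x) = cmod c * norm x" for x :: "'a :: complex_hilbert"
proof -
  have "complex_of_real ((norm (c *\<^sub>C x))\<^sup>2) = (c * cnj c) * cinner x x"
    unfolding cinner_self[symmetric] by (simp only: cinner_scaleC_left cinner_scaleC_right mult_ac)
  also have "\<dots> = complex_of_real ((cmod c * norm x)\<^sup>2)"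
    by (simp only: cinner_self complex_norm_square[symmetric] power_mult_distrib of_real_mult)
  finally have "(norm (c *\<^sub>C x))\<^sup>2 = (cmod c * norm x)\<^sup>2"
    by (simp only: of_real_eq_iff)
  then show ?thesis by simp
qed

lemma bounded_linear_scaleC: "bounded_linear (\<lambda>x. c *\<^sub>C x :: 'a :: complex_hilbert)"
  by (rule bounded_linear_intro[where K = "cmod c"])
    (simp_all add: scaleC_add_right scaleR_eq_scaleC scaleC_scaleC norm_scaleC mult_ac)

text \<open>Both parts are real inner products, which is how continuity and Cauchy-Schwarz are
  inherited from the real structure.\<close>

lemma cinner_eq: "cinner x y = Complex (inner x y) (inner x (\<i> *\<^sub>C y))"
  for x :: "'a :: complex_hilbert"
  by (rule complex_eqI) (simp_all add: Re_cinner[symmetric] cinner_scaleC_right)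

lemma tendsto_cinner:
  fixes f g :: "'b \<Rightarrow> 'a :: complex_hilbert"
  assumes "(f \<longlongrightarrow> a) F" "(g \<longlongrightarrow> b) F"
  shows "((\<lambda>x. cinner (f x) (g x)) \<longlongrightarrow> cinner a b) F"
  unfolding cinner_eq
  by (intro tendsto_Complex tendsto_inner assms bounded_linear.tendsto[OF bounded_linear_scaleC])

lemma continuous_on_cinner:
  fixes f g :: "'b :: topological_space \<Rightarrow> 'a :: complex_hilbert"
  assumes "continuous_on A f" "continuous_on A g"
  shows "continuous_on A (\<lambda>x. cinner (f x) (g x))"
  using assms unfolding continuous_on_def by (auto intro: tendsto_cinner)

lemma csubspaceD:
  assumes "csubspace V"
  shows "0 \<in> V" "x \<in> V \<Longrightarrow> y \<in> V \<Longrightarrow> x + y \<in> V" "x \<in> V \<Longrightarrow> y \<in> V \<Longrightarrow> x - y \<in> V"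
    "x \<in> V \<Longrightarrow> c *\<^sub>C x \<in> V" "x \<in> V \<Longrightarrow> - x \<in> V"
  by (fact complex_vector.subspace_0[OF assms] complex_vector.subspace_add[OF assms]
      complex_vector.subspace_diff[OF assms] complex_vector.subspace_scale[OF assms]
      complex_vector.subspace_neg[OF assms])+

lemma csubspace_imp_subspace: "csubspace V \<Longrightarrow> subspace V"
  by (auto simp: subspace_def scaleR_eq_scaleC intro: csubspaceD)

lemma closure_csubspace:
  assumes "csubspace V"
  shows "csubspace (closure V)"
proof (rule complex_vector.subspaceI)
  show "0 \<in> closure V" using csubspaceD(1)[OF assms] closure_subset by blast
next
  fix x y assume "x \<in> closure V" "y \<in> closure V"
  then obtain f g where "\<And>n::nat. f n \<in> V" "f \<longlonglongrightarrow> x" "\<And>n::nat. g n \<in> V" "g \<longlonglongrightarrow> y"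
    unfolding closure_sequential by blast
  then show "x + y \<in> closure V"
    unfolding closure_sequential
    by (intro exI[of _ "\<lambda>n. f n + g n"]) (auto intro: tendsto_add csubspaceD[OF assms])
next
  fix c x assume "x \<in> closure V"
  then obtain f where "\<And>n::nat. f n \<in> V" "f \<longlonglongrightarrow> x" unfolding closure_sequential by blast
  then show "c *\<^sub>C x \<in> closure V"
    unfolding closure_sequential
    by (intro exI[of _ "\<lambda>n. c *\<^sub>C f n"])
      (auto intro: bounded_linear.tendsto[OF bounded_linear_scaleC] csubspaceD[OF assms])
qed

lemma csubspace_ominus: "csubspace A \<Longrightarrow> csubspace (A \<ominus> B)"
  by (rule complex_vector.subspaceI) (auto simp: ominus_def cinner_simps csubspaceD)

lemma closed_ominus:
  assumes "closed A"
  shows "closed (A \<ominus> B)"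
proof -
  have "A \<ominus> B = A \<inter> (\<Inter>y\<in>B. {x. cinner x y = 0})" by (auto simp: ominus_def)
  moreover have "closed {x :: 'a. cinner x y = 0}" for y
    by (intro closed_Collect_eq continuous_on_cinner continuous_intros)
  ultimately show ?thesis using assms by (auto intro!: closed_Int closed_INT)
qed

lemma closed_csubspace_ominus: "closed_csubspace A \<Longrightarrow> closed_csubspace (A \<ominus> B)"
  by (simp add: closed_csubspace_def csubspace_ominus closed_ominus)

lemma closed_csubspace_UNIV: "closed_csubspace UNIV"
  by (simp add: closed_csubspace_def complex_vector.subspace_UNIV)

subsection \<open>Orthogonal projections\<close>

text \<open>The midpoint of two near-minimisers stays in the convex set, so the parallelogram law
  bounds their distance and a minimising sequence is Cauchy.\<close>

lemma minimal_distance_attained: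
  fixes V :: "'a :: {real_inner, complete_space} set"
  assumes "convex V" "closed V" "V \<noteq> {}"
  shows "\<exists>y\<in>V. \<forall>z\<in>V. norm (x - y) \<le> norm (x - z)"
proof -
  define d where "d = Inf ((\<lambda>z. (norm (x - z))\<^sup>2) ` V)"
  have bdd: "bdd_below ((\<lambda>z. (norm (x - z))\<^sup>2) ` V)" by (rule bdd_belowI[of _ 0]) auto
  have lower: "d \<le> (norm (x - z))\<^sup>2" if "z \<in> V" for z
    unfolding d_def by (rule cInf_lower[OF _ bdd]) (use that in auto)
  have "\<exists>y\<in>V. (norm (x - y))\<^sup>2 < d + inverse (real (Suc n))" for n
    using cInf_lessD[of "(\<lambda>z. (norm (x - z))\<^sup>2) ` V" "d + inverse (real (Suc n))"] assms(3)
    by (auto simp: d_def)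
  then obtain y where y: "\<And>n. y n \<in> V" "\<And>n. (norm (x - y n))\<^sup>2 < d + inverse (real (Suc n))"
    by metis
  have dist: "(norm (y m - y n))\<^sup>2 \<le> 2 * inverse (real (Suc m)) + 2 * inverse (real (Suc n))" for m n
  proof -
    have "(1/2) *\<^sub>R y m + (1/2) *\<^sub>R y n \<in> V"
      using assms(1) y(1) by (intro convexD) auto
    note mid = lower[OF this]
    have "(norm (y m - y n))\<^sup>2 = 2 * (norm (x - y m))\<^sup>2 + 2 * (norm (x - y n))\<^sup>2
      - 4 * (norm (x - ((1/2) *\<^sub>R y m + (1/2) *\<^sub>R y n)))\<^sup>2"
      by (simp add: power2_norm_eq_inner inner_simps inner_commute algebra_simps)
    then show ?thesis using mid y(2)[of m] y(2)[of n] by linarith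
  qed
  have "Cauchy y"
  proof (rule metric_CauchyI)
    fix e :: real assume "0 < e"
    then obtain M where M: "inverse (real (Suc M)) < e\<^sup>2 / 4"
      using reals_Archimedean[of "e\<^sup>2 / 4"] by auto
    have "dist (y m) (y n) < e" if "M \<le> m" "M \<le> n" for m n
    proof -
      have "inverse (real (Suc m)) \<le> inverse (real (Suc M))"
        "inverse (real (Suc n)) \<le> inverse (real (Suc M))"
        using that by (auto intro!: le_imp_inverse_le)
      then have "(norm (y m - y n))\<^sup>2 < e\<^sup>2" using dist[of m n] M by linarith
      then show ?thesis using \<open>0 < e\<close> by (simp add: dist_norm power2_less_imp_less)
    qed
    then show "\<exists>M. \<forall>m\<ge>M. \<forall>n\<ge>M. dist (y m) (y n) < e" by blast
  qed
  then obtain l where l: "y \<longlonglongrightarrow> l" using Cauchy_convergent convergent_def by blast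
  have "l \<in> V" using closed_sequentially[OF assms(2)] y(1) l by blast
  moreover have "(norm (x - l))\<^sup>2 \<le> d"
  proof (rule LIMSEQ_le)
    show "(\<lambda>n. (norm (x - y n))\<^sup>2) \<longlonglongrightarrow> (norm (x - l))\<^sup>2" by (intro tendsto_intros l)
    show "(\<lambda>n. d + inverse (real (Suc n))) \<longlonglongrightarrow> d"
      using tendsto_add[OF tendsto_const LIMSEQ_inverse_real_of_nat] by simp
    show "\<exists>N. \<forall>n\<ge>N. (norm (x - y n))\<^sup>2 \<le> d + inverse (real (Suc n))"
      using y(2) less_imp_le by blast
  qed
  ultimately show ?thesis using lower by (meson norm_ge_zero order_trans power2_le_imp_le)
qed

lemma proj_exists:
  assumes "closed_csubspace V"
  shows "\<exists>y\<in>V. \<forall>z\<in>V. cinner (x - y) z = 0"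
proof -
  have V: "csubspace V" "closed V" using assms by (auto simp: closed_csubspace_def)
  obtain y where y: "y \<in> V" "\<And>z. z \<in> V \<Longrightarrow> norm (x - y) \<le> norm (x - z)"
    using minimal_distance_attained[of V x] V csubspace_imp_subspace[OF V(1)]
      subspace_imp_convex csubspaceD(1) by blast
  have inner: "inner (x - y) z = 0" if z: "z \<in> V" for z
  proof (cases "z = 0")
    case False
    \<comment> \<open>The minimiser of the quadratic
      \<open>(norm (x - (y + t *\<^sub>R z)))\<^sup>2\<close> in \<open>t\<close>; a nonzero slope
      at \<open>t = 0\<close> would lower the minimal distance.\<close>
    define t where "t = inner (x - y) z / (norm z)\<^sup>2"
    have "y + t *\<^sub>R z \<in> V" using y(1) z V(1) by (auto simp: scaleR_eq_scaleC intro: csubspaceD)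
    then have "(norm (x - y))\<^sup>2 \<le> (norm (x - (y + t *\<^sub>R z)))\<^sup>2"
      using y(2) by (simp add: power_mono)
    also have "\<dots> = (norm (x - y))\<^sup>2 - 2 * t * inner (x - y) z + t\<^sup>2 * (norm z)\<^sup>2"
      unfolding power2_norm_eq_inner
      by (simp add: inner_simps inner_commute algebra_simps power2_eq_square)
    also have "\<dots> = (norm (x - y))\<^sup>2 - (inner (x - y) z)\<^sup>2 / (norm z)\<^sup>2"
      using False by (simp add: t_def power2_eq_square field_simps)
    finally have "(inner (x - y) z)\<^sup>2 / (norm z)\<^sup>2 \<le> 0" by simp
    then show ?thesis using False by (simp add: divide_le_0_iff)
  qed simp
  \<comment> \<open>The real inner product with \<open>\<i> *\<^sub>C z\<close> supplies the
    imaginary part.\<close>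
  have "cinner (x - y) z = 0" if "z \<in> V" for z
    using inner[OF that] inner[OF csubspaceD(4)[OF V(1) that, of \<i>]]
    by (simp add: cinner_eq complex_eq_iff)
  then show ?thesis using y(1) by blast
qed

lemma proj_unique:
  assumes "closed_csubspace V" "y \<in> V" "\<And>z. z \<in> V \<Longrightarrow> cinner (x - y) z = 0"
  shows "proj V x = y"
  unfolding proj_def
proof (rule the_equality)
  show "y \<in> V \<and> (\<forall>z\<in>V. cinner (x - y) z = 0)" using assms by blast
next
  fix y' assume y': "y' \<in> V \<and> (\<forall>z\<in>V. cinner (x - y') z = 0)"
  then have "y - y' \<in> V" using assms by (auto simp: closed_csubspace_def intro: csubspaceD)
  then have "cinner (x - y') (y - y') - cinner (x - y) (y - y') = 0" using y' assms by auto
  then have "cinner (y - y') (y - y') = 0" by (simp add: cinner_diff_left)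
  then show "y' = y" by simp
qed

lemma proj_in: "closed_csubspace V \<Longrightarrow> proj V x \<in> V"
  and proj_orth: "closed_csubspace V \<Longrightarrow> z \<in> V \<Longrightarrow> cinner (x - proj V x) z = 0"
  using proj_exists[of V x] proj_unique[of V _ x] by metis+

lemma cinner_proj_left: "closed_csubspace V \<Longrightarrow> z \<in> V \<Longrightarrow> cinner (proj V x) z = cinner x z"
  using proj_orth[of V z x] by (simp add: cinner_diff_left)

lemma cinner_proj_right: "closed_csubspace V \<Longrightarrow> z \<in> V \<Longrightarrow> cinner z (proj V x) = cinner z x"
  using cinner_proj_left[of V z x] cinner_commute by metis

lemma proj_ident: "closed_csubspace V \<Longrightarrow> x \<in> V \<Longrightarrow> proj V x = x"
  by (rule proj_unique) auto

lemma proj_eq_0: "closed_csubspace V \<Longrightarrow> (\<And>z. z \<in> V \<Longrightarrow> cinner x z = 0) \<Longrightarrow> proj V x = 0"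
  by (rule proj_unique) (auto simp: closed_csubspace_def csubspaceD)

lemma
  assumes "closed_csubspace V"
  shows proj_add: "proj V (x + y) = proj V x + proj V y"
    and proj_scaleC: "proj V (c *\<^sub>C x) = c *\<^sub>C proj V x"
    and proj_diff: "proj V (x - y) = proj V x - proj V y"
  by (rule proj_unique, rule assms, use assms in \<open>auto simp: cinner_simps cinner_proj_left
        closed_csubspace_def intro!: csubspaceD proj_in[OF assms]\<close>)+

lemma proj_zero: "closed_csubspace V \<Longrightarrow> proj V 0 = 0"
  by (rule proj_eq_0) simp_all

lemma proj_minus: "closed_csubspace V \<Longrightarrow> proj V (- x) = - proj V x"
  using proj_diff[of V 0 x] by (simp add: proj_zero)

lemma norm_proj_le:
  assumes "closed_csubspace V"
  shows "norm (proj V x) \<le> norm x"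
proof -
  have "inner (proj V x) (proj V x) = inner x (proj V x)"
    using cinner_proj_left[OF assms proj_in[OF assms], of x x] by (metis Re_cinner)
  also have "\<dots> \<le> norm x * norm (proj V x)" by (rule norm_cauchy_schwarz)
  finally have "norm (proj V x) * norm (proj V x) \<le> norm x * norm (proj V x)"
    by (simp add: power2_norm_eq_inner[symmetric] power2_eq_square)
  then show ?thesis
    by (metis mult_right_le_imp_le norm_ge_zero order.order_iff_strict)
qed

lemma bounded_linear_proj:
  assumes "closed_csubspace V"
  shows "bounded_linear (proj V)"
  by (rule bounded_linear_intro[where K = 1])
    (simp_all add: proj_add proj_scaleC norm_proj_le scaleR_eq_scaleC assms)

lemma ominus_eq_0_imp_eq:
  assumes "closed_csubspace V" "csubspace M" "V \<subseteq> M" "M \<ominus> V = {0}"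
  shows "V = M"
proof -
  have "x \<in> V" if "x \<in> M" for x
  proof -
    have "x - proj V x \<in> M \<ominus> V"
      using assms(2,3) that proj_in[OF assms(1)] proj_orth[OF assms(1)]
      by (auto simp: ominus_def intro!: csubspaceD)
    then have "x - proj V x = 0" using assms(4) by blast
    then show ?thesis using proj_in[OF assms(1), of x] by simp
  qed
  then show ?thesis using assms by auto
qed

lemma ominus_ominus:
  assumes "closed_csubspace V" "csubspace M" "V \<subseteq> M"
  shows "M \<ominus> (M \<ominus> V) = V"
proof
  show "V \<subseteq> M \<ominus> (M \<ominus> V)" using assms by (auto simp: ominus_def cinner_eq_0_commute)
  show "M \<ominus> (M \<ominus> V) \<subseteq> V"
  proof
    fix x assume x: "x \<in> M \<ominus> (M \<ominus> V)"
    then have "x - proj V x \<in> M \<ominus> V"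
      using assms proj_in[OF assms(1)] proj_orth[OF assms(1)]
      by (auto simp: ominus_def intro!: csubspaceD)
    then have "cinner x (x - proj V x) = 0" "cinner (proj V x) (x - proj V x) = 0"
      using x proj_in[OF assms(1), of x] by (auto simp: ominus_def cinner_eq_0_commute)
    then have "cinner (x - proj V x) (x - proj V x) = 0" by (simp add: cinner_diff_left)
    then show "x \<in> V" using proj_in[OF assms(1), of x] by auto
  qed
qed

section \<open>Shifted ranges of linear relations\<close>

definition range_minus :: "'a :: complex_hilbert graph \<Rightarrow> complex \<Rightarrow> 'a set"
  where "range_minus T c = {g - c *\<^sub>C f | f g. (f, g) \<in> T}"

lemma deficiency_subspace_eq: "deficiency_subspace K T \<mu> = K \<ominus> range_minus T (cnj \<mu>)"
  by (simp add: deficiency_subspace_def range_minus_def)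

lemma csubspace_range_minus:
  assumes "csubspace T"
  shows "csubspace (range_minus T c)"
proof (rule complex_vector.subspaceI)
  show "0 \<in> range_minus T c"
    using csubspaceD(1)[OF assms]
    by (auto simp: range_minus_def zero_prod_def intro!: exI[of _ "0 :: 'a"])
next
  fix x y assume "x \<in> range_minus T c" "y \<in> range_minus T c"
  then obtain f g f' g' where *: "(f, g) \<in> T" "(f', g') \<in> T" "x = g - c *\<^sub>C f" "y = g' - c *\<^sub>C f'"
    by (auto simp: range_minus_def)
  have "(f + f', g + g') \<in> T" using csubspaceD(2)[OF assms *(1,2)] by simp
  then show "x + y \<in> range_minus T c"
    unfolding range_minus_def mem_Collect_eq *(3,4)
    by (intro exI[of _ "f + f'"] exI[of _ "g + g'"]) (simp add: scaleC_add_right)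
next
  fix a x assume "x \<in> range_minus T c"
  then obtain f g where *: "(f, g) \<in> T" "x = g - c *\<^sub>C f"
    by (auto simp: range_minus_def)
  have "(a *\<^sub>C f, a *\<^sub>C g) \<in> T" using csubspaceD(4)[OF assms *(1), of a] by (simp add: scaleC_prod_def)
  then show "a *\<^sub>C x \<in> range_minus T c"
    unfolding range_minus_def mem_Collect_eq *(2)
    by (intro exI[of _ "a *\<^sub>C f"] exI[of _ "a *\<^sub>C g"])
      (simp add: complex_vector.scale_right_diff_distrib scaleC_scaleC mult.commute)
qed

lemma abs_Im_cinner_le: "\<bar>Im (cinner x y)\<bar> \<le> norm x * norm y" for x :: "'a :: complex_hilbert"
  using Cauchy_Schwarz_ineq2[of x "\<i> *\<^sub>C y"] by (simp add: cinner_eq norm_scaleC)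

subsection \<open>Symmetric relations\<close>

text \<open>Single-valuedness is not built in: the locale can then hold extensions not yet known to
  be operators, and for dense domains it follows from symmetry.\<close>

locale symmetric_relation =
  fixes T :: "'a :: complex_hilbert graph"
  assumes csubspace_T: "csubspace T"
    and symmetric: "(f, g) \<in> T \<Longrightarrow> Im (cinner g f) = 0"
begin

lemma T_add: "(f, g) \<in> T \<Longrightarrow> (f', g') \<in> T \<Longrightarrow> (f + f', g + g') \<in> T"
  and T_diff: "(f, g) \<in> T \<Longrightarrow> (f', g') \<in> T \<Longrightarrow> (f - f', g - g') \<in> T"
  and T_scale: "(f, g) \<in> T \<Longrightarrow> (c *\<^sub>C f, c *\<^sub>C g) \<in> T"
  and T_zero: "(0, 0) \<in> T"
  using csubspaceD(2,3)[OF csubspace_T, of "(f, g)" "(f', g')"] csubspaceD(1)[OF csubspace_T]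
    csubspaceD(4)[OF csubspace_T, of "(f, g)" c]
  by (simp_all add: scaleC_prod_def zero_prod_def)

text \<open>Polarisation: the quadratic form on the sum of the two pairs gives the imaginary parts,
  and multiplying the second pair by \<open>\<i>\<close> gives the real parts.\<close>

lemma symmetric_polar:
  assumes "(f, g) \<in> T" "(f', g') \<in> T"
  shows "cinner g f' = cinner f g'"
proof -
  have Im0: "Im (cinner g f' - cinner f g') = 0" if "(f', g') \<in> T" for f' g'
    using symmetric[OF T_add[OF assms(1) that]] symmetric[OF assms(1)] symmetric[OF that]
      arg_cong[OF cinner_commute[of g' f], of Im]
    by (simp add: cinner_simps)
  show ?thesis
    using Im0[OF assms(2)] Im0[OF T_scale[OF assms(2), of \<i>]]
    by (simp add: cinner_simps complex_eq_iff)
qed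

text \<open>The quadratic form of \<open>T\<close> is real, so the imaginary part of that of
  \<open>T - c\<close> is \<open>- Im c * (norm f)\<^sup>2\<close>; Cauchy-Schwarz does the
  rest.\<close>

lemma norm_le_range_minus:
  assumes "(f, g) \<in> T"
  shows "\<bar>Im c\<bar> * norm f \<le> norm (g - c *\<^sub>C f)"
proof -
  have "Im (cinner (g - c *\<^sub>C f) f) = - Im c * (norm f)\<^sup>2"
    using symmetric[OF assms] by (simp add: cinner_simps cinner_self)
  then have "(\<bar>Im c\<bar> * norm f) * norm f \<le> norm (g - c *\<^sub>C f) * norm f"
    using abs_Im_cinner_le[of "g - c *\<^sub>C f" f] by (simp add: abs_mult power2_eq_square)
  then show ?thesis
    by (cases "f = 0") simp_all
qed

text \<open>The map that takes a pair of the graph to its value in the shifted range is bounded, and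
  bounded below by the preceding estimate, so it carries closedness both ways.\<close>

lemma closed_range_minus_iff:
  assumes "Im c \<noteq> 0"
  shows "closed (range_minus T c) \<longleftrightarrow> closed T"
proof -
  define F where "F p = snd p - c *\<^sub>C fst p" for p :: "'a \<times> 'a"
  \<comment> \<open>Obtained by adding \<open>norm f \<le> norm (F p) / \<bar>Im c\<bar>\<close> and
    \<open>norm g \<le> norm (F p) + cmod c * norm f\<close>.\<close>
  define C where "C = 1 + (1 + cmod c) / \<bar>Im c\<bar>"
  have "C > 0" unfolding C_def by (intro add_pos_nonneg divide_nonneg_nonneg) auto
  have F: "bounded_linear F"
    unfolding F_def by (intro bounded_linear_sub bounded_linear_snd
        bounded_linear_compose[OF bounded_linear_scaleC bounded_linear_fst])
  have image: "F ` T = range_minus T c" by (force simp: F_def range_minus_def)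
  have bound: "norm p \<le> C * norm (F p)" if "p \<in> T" for p
  proof -
    obtain f g where p: "p = (f, g)" by fastforce
    have "norm f \<le> norm (F p) / \<bar>Im c\<bar>"
      using norm_le_range_minus[of f g c] that assms
      by (simp add: p F_def pos_le_divide_eq mult.commute)
    moreover have "norm g \<le> norm (F p) + cmod c * norm f"
      using norm_triangle_ineq[of "F p" "c *\<^sub>C f"] by (simp add: p F_def norm_scaleC)
    moreover have "norm p \<le> norm f + norm g" by (simp add: p norm_Pair_le)
    ultimately have "norm p \<le> norm (F p) + (1 + cmod c) * norm f" by (simp add: algebra_simps)
    also have "\<dots> \<le> norm (F p) + (1 + cmod c) * (norm (F p) / \<bar>Im c\<bar>)"
      using \<open>norm f \<le> _\<close> by (intro add_left_mono mult_left_mono) auto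
    finally show ?thesis by (simp add: C_def algebra_simps)
  qed
  have "closed (range_minus T c)" if "closed T"
  proof -
    have "complete (F ` T)"
    proof (rule complete_isometric_image[where e = "1 / C"])
      show "\<forall>x\<in>T. 1 / C * norm x \<le> norm (F x)"
        using bound \<open>C > 0\<close> by (simp add: field_simps)
    qed (use \<open>C > 0\<close> F csubspace_T that in \<open>simp_all add: csubspace_imp_subspace complete_eq_closed\<close>)
    then show ?thesis by (simp add: image complete_imp_closed)
  qed
  moreover have "closed T" if "closed (range_minus T c)"
  unfolding closed_sequential_limits
  proof safe
    fix p l assume p: "\<forall>n. p n \<in> T" "p \<longlonglongrightarrow> l"
    then have lim: "(\<lambda>n. F (p n)) \<longlonglongrightarrow> F l" using bounded_linear.tendsto[OF F] by blast
    moreover have "\<forall>n. F (p n) \<in> range_minus T c" using p(1) image by blast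
    ultimately have "F l \<in> range_minus T c" using that closed_sequentially by metis
    \<comment> \<open>As \<open>F\<close> is bounded below on \<open>T\<close>, convergence of
      \<open>F (p n)\<close> to \<open>F q\<close> forces \<open>p n\<close> to converge to
      \<open>q\<close>, which lies in \<open>T\<close>.\<close>
    then obtain q where q: "q \<in> T" "F l = F q" unfolding image[symmetric] by blast
    have "(\<lambda>n. p n - q) \<longlonglongrightarrow> 0"
    proof (rule Lim_null_comparison)
      show "\<forall>\<^sub>F n in sequentially. norm (p n - q) \<le> C * norm (F (p n) - F q)"
        using bound[OF csubspaceD(3)[OF csubspace_T]] p(1) q(1)
        by (simp add: bounded_linear.linear[OF F, THEN linear_diff])
      have "(\<lambda>n. C * norm (F (p n) - F q)) \<longlonglongrightarrow> C * norm (F l - F q)"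
        by (intro tendsto_intros lim)
      then show "(\<lambda>n. C * norm (F (p n) - F q)) \<longlonglongrightarrow> 0" by (simp add: q)
    qed
    then have "p \<longlonglongrightarrow> q" using LIM_zero_iff by blast
    then show "l \<in> T" using p(2) q(1) LIMSEQ_unique by blast
  qed
  ultimately show ?thesis by blast
qed

lemma closed_csubspace_range_minus:
  "closed T \<Longrightarrow> Im c \<noteq> 0 \<Longrightarrow> closed_csubspace (range_minus T c)"
  by (simp add: closed_csubspace_def csubspace_range_minus csubspace_T closed_range_minus_iff)

end

text \<open>The weak form of "the adjoint sends \<open>x\<close> to
  \<open>\<mu> *\<^sub>C x\<close>", meaningful also for a domain that is not dense.\<close>

lemma deficiency_subspace_iff:
  "x \<in> deficiency_subspace K T \<mu> \<longleftrightarrow> x \<in> K \<and> (\<forall>(f, g)\<in>T. cinner x g = \<mu> * cinner x f)"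
proof -
  have "cinner x (g - cnj \<mu> *\<^sub>C f) = 0 \<longleftrightarrow> cinner x g = \<mu> * cinner x f" for f g
    by (simp add: cinner_simps)
  then show ?thesis
    unfolding deficiency_subspace_def ominus_def by blast
qed

lemma closed_csubspace_deficiency:
  "closed_csubspace K \<Longrightarrow> closed_csubspace (deficiency_subspace K T \<mu>)"
  by (simp add: deficiency_subspace_def closed_csubspace_ominus)

text \<open>The ambient space is a set \<open>K\<close> because the compression of \<open>S\<close>
  acts in the subspace \<open>H0 S\<close>, which is not a type of its own.\<close>

locale dense_symmetric = symmetric_relation T for T :: "'a :: complex_hilbert graph" +
  fixes K :: "'a set"
  assumes T_sub: "T \<subseteq> K \<times> K" and dense: "closure (Domain T) = K"
begin

lemma closed_csubspace_K: "closed_csubspace K"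
proof -
  have "csubspace (Domain T)"
    using T_zero by (intro complex_vector.subspaceI) (auto intro: T_add T_scale)
  then show ?thesis
    using closure_csubspace dense by (auto simp: closed_csubspace_def)
qed

lemma csubspace_K: "csubspace K" and closed_K: "closed K"
  using closed_csubspace_K by (auto simp: closed_csubspace_def)

lemma orth_Domain_imp_0:
  assumes "x \<in> K" "\<And>f g. (f, g) \<in> T \<Longrightarrow> cinner x f = 0"
  shows "x = 0"
proof -
  have "closure (Domain T) \<subseteq> {y. cinner x y = 0}"
    by (rule closure_minimal)
      (use assms(2) in \<open>auto intro!: closed_Collect_eq continuous_on_cinner continuous_intros\<close>)
  then show ?thesis using assms(1) dense by auto
qed

text \<open>The difference of two values at one vector is paired with zero in \<open>T\<close>;
  symmetry makes it orthogonal to the dense domain.\<close>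

lemma linear_operator_T: "linear_operator T"
  unfolding linear_operator_def
proof (intro conjI csubspace_T single_valuedI)
  fix f g g' assume "(f, g) \<in> T" "(f, g') \<in> T"
  then have *: "(0, g - g') \<in> T" using T_diff by fastforce
  have "g - g' = 0"
  proof (rule orth_Domain_imp_0)
    show "g - g' \<in> K" using * T_sub by auto
    show "cinner (g - g') f' = 0" if "(f', g'') \<in> T" for f' g''
      using symmetric_polar[OF * that] by simp
  qed
  then show "g = g'" by simp
qed

lemma closed_operator_iff: "closed_operator T \<longleftrightarrow> closed T"
  by (simp add: closed_operator_def linear_operator_T)

lemma range_minus_sub: "range_minus T c \<subseteq> K"
  using T_sub by (auto simp: range_minus_def intro!: csubspaceD csubspace_K)

lemma T_subset_adjoint: "T \<subseteq> adjoint_in K T"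
  using T_sub symmetric_polar by (auto simp: adjoint_in_def)

text \<open>Left to right, a nonzero vector orthogonal to a shifted range would be an eigenvector of
  the adjoint for \<open>\<i>\<close> or \<open>- \<i>\<close>, which a real quadratic form
  excludes. Right to left, one full range matches an element of the adjoint with one of
  \<open>T\<close>, and the other full range shows that they agree.\<close>

lemma selfadjoint_in_iff:
  "selfadjoint_in K T \<longleftrightarrow> range_minus T (- \<i>) = K \<and> range_minus T \<i> = K"
proof
  assume sa: "selfadjoint_in K T"
  \<comment> \<open>An intersection of closed conditions, so a selfadjoint \<open>T\<close> is
    closed and so are its shifted ranges.\<close>
  have "adjoint_in K T = (K \<times> K) \<inter> (\<Inter>q\<in>T. {p. cinner (snd q) (fst p) = cinner (fst q) (snd p)})"
    by (force simp: adjoint_in_def)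
  moreover have "closed {p :: 'a \<times> 'a. cinner g (fst p) = cinner f (snd p)}" for f g
    by (intro closed_Collect_eq continuous_on_cinner continuous_intros)
  ultimately have "closed (adjoint_in K T)"
    by (auto intro!: closed_Int closed_INT closed_Times closed_K)
  then have "closed T" using sa by (simp add: selfadjoint_in_def)
  have "range_minus T c = K" if c: "c * c = - 1" "cnj c = - c" "Im c \<noteq> 0" for c
  proof (rule ominus_eq_0_imp_eq)
    show "closed_csubspace (range_minus T c)"
      using \<open>closed T\<close> that closed_csubspace_range_minus by blast
    have "x = 0" if "x \<in> K \<ominus> range_minus T c" for x
    proof -
      have "x \<in> deficiency_subspace K T (- c)"
        using that c by (simp add: deficiency_subspace_eq)
      then have x: "x \<in> K" "\<And>f g. (f, g) \<in> T \<Longrightarrow> cinner x g = - c * cinner x f"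
        unfolding deficiency_subspace_iff by auto
      have "cinner g x = cinner f (- c *\<^sub>C x)" if "(f, g) \<in> T" for f g
        using arg_cong[OF x(2)[OF that], of cnj] c(2)
        by (simp add: cinner_simps cinner_commute[symmetric])
      then have "(x, - c *\<^sub>C x) \<in> adjoint_in K T"
        using x(1) by (auto simp: adjoint_in_def intro: csubspaceD csubspace_K)
      then have "(x, - c *\<^sub>C x) \<in> T" using sa by (simp add: selfadjoint_in_def)
      from symmetric[OF this] have "Im (cinner (- c *\<^sub>C x) x) = 0" .
      then show ?thesis using c(3) by (simp add: cinner_simps cinner_self)
    qed
    then show "K \<ominus> range_minus T c = {0}"
      by (auto simp: ominus_def csubspaceD(1)[OF csubspace_K])
  qed (use csubspace_K range_minus_sub in auto)
  then show "range_minus T (- \<i>) = K \<and> range_minus T \<i> = K" by simp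
next
  assume ran: "range_minus T (- \<i>) = K \<and> range_minus T \<i> = K"
  have "adjoint_in K T \<subseteq> T"
  proof
    fix p assume p: "p \<in> adjoint_in K T"
    obtain u v where uv: "p = (u, v)" by fastforce
    from p have uvK: "u \<in> K" "v \<in> K" and adj: "\<And>f g. (f, g) \<in> T \<Longrightarrow> cinner g u = cinner f v"
      by (auto simp: adjoint_in_def uv)
    \<comment> \<open>Solving for \<open>(f, g)\<close> in \<open>T\<close> with the same shifted
      value makes \<open>u - f\<close> a weak eigenvector for \<open>- \<i>\<close>, hence
      orthogonal to \<open>range_minus T \<i>\<close>, which is all of \<open>K\<close> and contains
      \<open>u - f\<close>.\<close>
    have "v - (- \<i>) *\<^sub>C u \<in> K" using uvK by (intro csubspaceD csubspace_K)
    then obtain f g where fg: "(f, g) \<in> T" "v - (- \<i>) *\<^sub>C u = g - (- \<i>) *\<^sub>C f"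
      using ran by (auto simp: range_minus_def)
    have vg: "v - g = - \<i> *\<^sub>C (u - f)"
      using fg(2) by (simp add: algebra_simps complex_vector.scale_minus_left
          complex_vector.scale_right_diff_distrib)
    have "u - f \<in> K"
      using uvK fg(1) T_sub by (auto intro!: csubspaceD csubspace_K)
    then have "u - f \<in> range_minus T \<i>" using ran by simp
    then obtain f' g' where fg': "(f', g') \<in> T" "u - f = g' - \<i> *\<^sub>C f'"
      by (auto simp: range_minus_def)
    have "cinner g' (u - f) = cinner f' (v - g)"
      using adj[OF fg'(1)] symmetric_polar[OF fg'(1) fg(1)] by (simp add: cinner_simps)
    then have "cinner (g' - \<i> *\<^sub>C f') (u - f) = 0"
      unfolding vg by (simp add: cinner_simps algebra_simps)
    then have "u - f = 0" unfolding fg'(2)[symmetric] by simp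
    then show "p \<in> T" using vg fg(1) by (simp add: uv)
  qed
  then show "selfadjoint_in K T"
    unfolding selfadjoint_in_def using linear_operator_T T_sub dense T_subset_adjoint by blast
qed

text \<open>Only \<^term>\<open>\<mu>\<close> and \<^term>\<open>\<nu>\<close> in the same half-plane are compared, so this is the part of
  the constancy of the deficiency indices that concerns the value zero.\<close>

lemma deficiency_subspace_trivial:
  assumes "closed T" "Im \<mu> * Im \<nu> > 0" "deficiency_subspace K T \<mu> = {0}"
  shows "deficiency_subspace K T \<nu> = {0}"
proof -
  have "Im \<mu> \<noteq> 0" using assms(2) by auto
  then have "closed_csubspace (range_minus T (cnj \<mu>))"
    using assms(1) closed_csubspace_range_minus by simp
  from ominus_eq_0_imp_eq[OF this csubspace_K range_minus_sub]
  have ran: "range_minus T (cnj \<mu>) = K"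
    using assms(3) unfolding deficiency_subspace_eq by blast
  have "\<phi> = 0" if "\<phi> \<in> deficiency_subspace K T \<nu>" for \<phi>
  proof -
    have \<phi>: "\<phi> \<in> K" "\<And>f g. (f, g) \<in> T \<Longrightarrow> cinner \<phi> g = \<nu> * cinner \<phi> f"
      using that unfolding deficiency_subspace_iff by auto
    \<comment> \<open>The pair \<open>(f, g)\<close> is chosen so that
      \<open>\<nu> *\<^sub>C \<phi> - g\<close> is a multiple of \<open>\<phi> - f\<close>. The
      imaginary part of their inner product, computed in two ways, has the sign of
      \<open>- Im \<mu>\<close> and that of \<open>Im \<nu>\<close>, so it must vanish.\<close>
    have "(\<nu> - cnj \<mu>) *\<^sub>C \<phi> \<in> K" using \<phi>(1) by (intro csubspaceD csubspace_K)
    then obtain f g where fg: "(f, g) \<in> T" "(\<nu> - cnj \<mu>) *\<^sub>C \<phi> = g - cnj \<mu> *\<^sub>C f"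
      using ran by (auto simp: range_minus_def)
    have "\<nu> *\<^sub>C \<phi> - g = cnj \<mu> *\<^sub>C (\<phi> - f)"
      using fg(2) by (simp add: algebra_simps complex_vector.scale_left_diff_distrib
          complex_vector.scale_right_diff_distrib)
    then have "Im (cinner (\<nu> *\<^sub>C \<phi> - g) (\<phi> - f)) = - Im \<mu> * (norm (\<phi> - f))\<^sup>2"
      by (simp add: cinner_scaleC_left cinner_self)
    moreover have "Im (cinner (\<nu> *\<^sub>C \<phi> - g) (\<phi> - f)) = Im \<nu> * (norm \<phi>)\<^sup>2"
      using symmetric[OF fg(1)] \<phi>(2)[OF fg(1)] arg_cong[OF cinner_commute[of g \<phi>], of Im]
      by (simp add: cinner_simps cinner_self)
    ultimately have "Im \<nu> * (norm \<phi>)\<^sup>2 = - Im \<mu> * (norm (\<phi> - f))\<^sup>2" by simp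
    from arg_cong[OF this, of "\<lambda>t. Im \<mu> * t"]
    have "Im \<mu> * Im \<nu> * (norm \<phi>)\<^sup>2 = - ((Im \<mu>)\<^sup>2 * (norm (\<phi> - f))\<^sup>2)"
      by (simp add: power2_eq_square mult_ac)
    then have "Im \<mu> * Im \<nu> * (norm \<phi>)\<^sup>2 \<le> 0" by simp
    then show "\<phi> = 0" using assms(2) by (metis mult_pos_pos not_le zero_less_norm_iff zero_less_power)
  qed
  moreover have "0 \<in> deficiency_subspace K T \<nu>"
    by (simp add: deficiency_subspace_iff csubspaceD(1)[OF csubspace_K] split: prod.splits)
  ultimately show ?thesis by blast
qed

end

subsection \<open>Extensions by partial isometries between deficiency subspaces\<close>

text \<open>The sum is the preimage of \<open>B\<close> under the continuous map
  \<open>x - proj R x\<close>, and \<open>B\<close> is recovered as the part of the sum orthogonal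
  to \<open>R\<close>, so closedness passes in both directions.\<close>

lemma
  assumes "closed_csubspace R" "csubspace B" "\<And>b r. b \<in> B \<Longrightarrow> r \<in> R \<Longrightarrow> cinner b r = 0"
  shows closed_orthogonal_sum_iff: "closed {r + b | r b. r \<in> R \<and> b \<in> B} \<longleftrightarrow> closed B"
    and orthogonal_sum_ominus: "{r + b | r b. r \<in> R \<and> b \<in> B} \<ominus> R = B"
proof -
  let ?W = "{r + b | r b. r \<in> R \<and> b \<in> B}"
  have R: "csubspace R" using assms(1) by (simp add: closed_csubspace_def)
  have orth: "cinner r b = 0" if "b \<in> B" "r \<in> R" for b r
    using assms(3)[OF that] cinner_eq_0_commute by blast
  have W: "?W = {x. x - proj R x \<in> B}"
  proof safe
    fix r b assume "r \<in> R" "b \<in> B"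
    then have "proj R (r + b) = r"
      by (intro proj_unique assms(1)) (simp_all add: assms(3))
    then show "r + b - proj R (r + b) \<in> B" using \<open>b \<in> B\<close> by simp
  next
    fix x assume "x - proj R x \<in> B"
    then show "\<exists>r b. x = r + b \<and> r \<in> R \<and> b \<in> B"
      using proj_in[OF assms(1), of x]
      by (intro exI[of _ "proj R x"] exI[of _ "x - proj R x"]) simp
  qed
  show *: "?W \<ominus> R = B"
  proof
    show "B \<subseteq> ?W \<ominus> R"
      using csubspaceD(1)[OF R] assms(3) by (force simp: ominus_def)
    show "?W \<ominus> R \<subseteq> B"
    proof
      fix x assume x: "x \<in> ?W \<ominus> R"
      then obtain r b where rb: "x = r + b" "r \<in> R" "b \<in> B" by (auto simp: ominus_def)
      have "cinner x r = 0" using x rb(2) by (auto simp: ominus_def)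
      then have "r = 0" using assms(3)[OF rb(3,2)] by (simp add: rb(1) cinner_add_left)
      then show "x \<in> B" using rb by simp
    qed
  qed
  show "closed ?W \<longleftrightarrow> closed B"
  proof
    assume "closed B"
    moreover have "continuous_on UNIV (\<lambda>x. x - proj R x)"
      by (intro continuous_intros linear_continuous_on bounded_linear_proj assms(1))
    ultimately show "closed ?W"
      unfolding W using continuous_closed_vimage[of B "\<lambda>x. x - proj R x"]
      by (auto simp: vimage_def continuous_on_eq_continuous_at)
  next
    assume "closed ?W"
    then show "closed B" using closed_ominus[of ?W R] * by simp
  qed
qed

text \<open>Von Neumann's formula. The adjoint of \<open>T\<close> sends \<open>\<alpha>\<close> to
  \<open>\<i> *\<^sub>C \<alpha>\<close> and \<open>\<beta>\<close> to
  \<open>- \<i> *\<^sub>C \<beta>\<close>, so the second entry is its value at the first. Giving the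
  isometry by its graph \<open>A\<close> treats domain and range alike.\<close>

definition vn_extension :: "'a :: complex_hilbert graph \<Rightarrow> 'a graph \<Rightarrow> 'a graph"
  where "vn_extension T A =
    {(f + \<alpha> - \<beta>, g + \<i> *\<^sub>C \<alpha> + \<i> *\<^sub>C \<beta>) | f g \<alpha> \<beta>. (f, g) \<in> T \<and> (\<alpha>, \<beta>) \<in> A}"

locale closed_dense_symmetric = dense_symmetric +
  assumes closed_T: "closed T"

locale isometric_extension = closed_dense_symmetric T K
  for T :: "'a :: complex_hilbert graph" and K +
  fixes A :: "'a graph"
  assumes csubspace_A: "csubspace A"
    and A_sub: "A \<subseteq> deficiency_subspace K T \<i> \<times> deficiency_subspace K T (- \<i>)"
    and isometric: "(\<alpha>, \<beta>) \<in> A \<Longrightarrow> norm \<alpha> = norm \<beta>"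
begin

lemma A_add: "(a, b) \<in> A \<Longrightarrow> (a', b') \<in> A \<Longrightarrow> (a + a', b + b') \<in> A"
  and A_scale: "(a, b) \<in> A \<Longrightarrow> (c *\<^sub>C a, c *\<^sub>C b) \<in> A"
  and A_zero: "(0, 0) \<in> A"
  using csubspaceD(2)[OF csubspace_A, of "(a, b)" "(a', b')"] csubspaceD(1)[OF csubspace_A]
    csubspaceD(4)[OF csubspace_A, of "(a, b)" c]
  by (simp_all add: scaleC_prod_def zero_prod_def)

lemma A_deficiency:
  assumes "(\<alpha>, \<beta>) \<in> A"
  shows "\<alpha> \<in> deficiency_subspace K T \<i>" "\<beta> \<in> deficiency_subspace K T (- \<i>)"
    "\<alpha> \<in> K" "\<beta> \<in> K"
    "(f, g) \<in> T \<Longrightarrow> cinner \<alpha> g = \<i> * cinner \<alpha> f"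
    "(f, g) \<in> T \<Longrightarrow> cinner \<beta> g = - \<i> * cinner \<beta> f"
proof -
  show *: "\<alpha> \<in> deficiency_subspace K T \<i>" "\<beta> \<in> deficiency_subspace K T (- \<i>)"
    using assms A_sub by auto
  show "\<alpha> \<in> K" "\<beta> \<in> K"
    "(f, g) \<in> T \<Longrightarrow> cinner \<alpha> g = \<i> * cinner \<alpha> f"
    "(f, g) \<in> T \<Longrightarrow> cinner \<beta> g = - \<i> * cinner \<beta> f"
    using * unfolding deficiency_subspace_iff by fast+
qed

lemma csubspace_Domain_A: "csubspace (Domain A)" and csubspace_Range_A: "csubspace (Range A)"
  using A_zero by (intro complex_vector.subspaceI; force intro: A_add A_scale)+

lemma vn_extensionI:
  "(f, g) \<in> T \<Longrightarrow> (\<alpha>, \<beta>) \<in> A \<Longrightarrow> u = f + \<alpha> - \<beta> \<Longrightarrow> v = g + \<i> *\<^sub>C \<alpha> + \<i> *\<^sub>C \<beta>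
    \<Longrightarrow> (u, v) \<in> vn_extension T A"
  unfolding vn_extension_def by blast

lemma vn_extensionE:
  assumes "(u, v) \<in> vn_extension T A"
  obtains f g \<alpha> \<beta> where "(f, g) \<in> T" "(\<alpha>, \<beta>) \<in> A"
    "u = f + \<alpha> - \<beta>" "v = g + \<i> *\<^sub>C \<alpha> + \<i> *\<^sub>C \<beta>"
  using assms unfolding vn_extension_def by blast

lemma csubspace_vn_extension: "csubspace (vn_extension T A)"
proof (rule complex_vector.subspaceI)
  show "0 \<in> vn_extension T A"
    unfolding zero_prod_def by (rule vn_extensionI[OF T_zero A_zero]) simp_all
next
  fix p q assume p: "p \<in> vn_extension T A" and q: "q \<in> vn_extension T A"
  obtain u v u' v' where pq: "p = (u, v)" "q = (u', v')" by fastforce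
  obtain f g \<alpha> \<beta> where 1: "(f, g) \<in> T" "(\<alpha>, \<beta>) \<in> A"
    "u = f + \<alpha> - \<beta>" "v = g + \<i> *\<^sub>C \<alpha> + \<i> *\<^sub>C \<beta>" using p pq vn_extensionE by metis
  obtain f' g' \<alpha>' \<beta>' where 2: "(f', g') \<in> T" "(\<alpha>', \<beta>') \<in> A"
    "u' = f' + \<alpha>' - \<beta>'" "v' = g' + \<i> *\<^sub>C \<alpha>' + \<i> *\<^sub>C \<beta>'" using q pq vn_extensionE by metis
  show "p + q \<in> vn_extension T A"
    unfolding pq add_Pair
    by (rule vn_extensionI[OF T_add[OF 1(1) 2(1)] A_add[OF 1(2) 2(2)]])
      (simp_all add: 1 2 scaleC_add_right)
next
  fix c p assume p: "p \<in> vn_extension T A"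
  obtain u v where pq: "p = (u, v)" by fastforce
  obtain f g \<alpha> \<beta> where 1: "(f, g) \<in> T" "(\<alpha>, \<beta>) \<in> A"
    "u = f + \<alpha> - \<beta>" "v = g + \<i> *\<^sub>C \<alpha> + \<i> *\<^sub>C \<beta>" using p pq vn_extensionE by metis
  have "(c *\<^sub>C u, c *\<^sub>C v) \<in> vn_extension T A"
    by (rule vn_extensionI[OF T_scale[OF 1(1)] A_scale[OF 1(2)]])
      (simp_all add: 1 scaleC_add_right complex_vector.scale_right_diff_distrib scaleC_scaleC mult.commute)
  then show "c *\<^sub>C p \<in> vn_extension T A" by (simp add: pq scaleC_prod_def)
qed

lemma T_subset_vn_extension: "T \<subseteq> vn_extension T A"
  using A_zero by (auto intro!: vn_extensionI)

lemma vn_extension_sub: "vn_extension T A \<subseteq> K \<times> K"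
proof safe
  fix u v assume "(u, v) \<in> vn_extension T A"
  then obtain f g \<alpha> \<beta> where 1: "(f, g) \<in> T" "(\<alpha>, \<beta>) \<in> A"
    "u = f + \<alpha> - \<beta>" "v = g + \<i> *\<^sub>C \<alpha> + \<i> *\<^sub>C \<beta>" by (rule vn_extensionE)
  have "f \<in> K" "g \<in> K" "\<alpha> \<in> K" "\<beta> \<in> K" using 1(1) T_sub A_deficiency(3,4)[OF 1(2)] by auto
  then show "u \<in> K" "v \<in> K" unfolding 1(3,4) by (simp_all add: csubspaceD csubspace_K)
qed

text \<open>The cross terms with \<open>T\<close> add up to a real number by the weak eigenvalue
  equations, and the isometric part contributes
  \<open>(norm \<alpha>)\<^sup>2 - (norm \<beta>)\<^sup>2\<close> to the imaginary part.\<close>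

lemma Im_cinner_vn_extension:
  assumes "(u, v) \<in> vn_extension T A"
  shows "Im (cinner v u) = 0"
proof -
  obtain f g \<alpha> \<beta> where 1: "(f, g) \<in> T" "(\<alpha>, \<beta>) \<in> A"
    "u = f + \<alpha> - \<beta>" "v = g + \<i> *\<^sub>C \<alpha> + \<i> *\<^sub>C \<beta>" using assms by (rule vn_extensionE)
  have *: "cinner g \<alpha> = - \<i> * cinner f \<alpha>" "cinner g \<beta> = \<i> * cinner f \<beta>"
    using arg_cong[OF A_deficiency(5)[OF 1(2,1)], of cnj]
      arg_cong[OF A_deficiency(6)[OF 1(2,1)], of cnj]
    by (simp_all add: cinner_commute[symmetric])
  have re: "Re (cinner \<alpha> f) = Re (cinner f \<alpha>)" "Re (cinner \<beta> f) = Re (cinner f \<beta>)"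
    "Re (cinner \<beta> \<alpha>) = Re (cinner \<alpha> \<beta>)"
    by (simp_all add: Re_cinner inner_commute)
  show ?thesis
    using symmetric[OF 1(1)] isometric[OF 1(2)]
    by (simp add: 1(3,4) cinner_simps * re cinner_self algebra_simps)
qed

text \<open>Density is inherited from \<open>T\<close>. Single-valuedness and the selfadjointness
  criterion thereby become available for the extension.\<close>

sublocale ext: dense_symmetric "vn_extension T A" K
proof (unfold_locales; (intro csubspace_vn_extension vn_extension_sub)?)
  show "Im (cinner g f) = 0" if "(f, g) \<in> vn_extension T A" for f g
    using that by (rule Im_cinner_vn_extension)
  show "closure (Domain (vn_extension T A)) = K"
  proof
    show "closure (Domain (vn_extension T A)) \<subseteq> K"
      using vn_extension_sub closed_K by (intro closure_minimal) auto
    show "K \<subseteq> closure (Domain (vn_extension T A))"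
      using closure_mono[OF Domain_mono[OF T_subset_vn_extension]] dense by simp
  qed
qed

text \<open>In \<open>v + \<i> u\<close> the vector \<open>\<beta>\<close> cancels, in
  \<open>v - \<i> u\<close> the vector \<open>\<alpha>\<close> does.\<close>

lemma range_minus_vn_extension:
  "range_minus (vn_extension T A) (- \<i>) = {r + b | r b. r \<in> range_minus T (- \<i>) \<and> b \<in> Domain A}"
  "range_minus (vn_extension T A) \<i> = {r + b | r b. r \<in> range_minus T \<i> \<and> b \<in> Range A}"
proof -
  have eqs: "(g + \<i> *\<^sub>C \<alpha> + \<i> *\<^sub>C \<beta>) - (- \<i>) *\<^sub>C (f + \<alpha> - \<beta>) = (g - (- \<i>) *\<^sub>C f) + (2 * \<i>) *\<^sub>C \<alpha>"
    "(g + \<i> *\<^sub>C \<alpha> + \<i> *\<^sub>C \<beta>) - \<i> *\<^sub>C (f + \<alpha> - \<beta>) = (g - \<i> *\<^sub>C f) + (2 * \<i>) *\<^sub>C \<beta>"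
    for f g \<alpha> \<beta> :: 'a
    unfolding mult_2 scaleC_add_left
    by (simp_all add: scaleC_add_right complex_vector.scale_right_diff_distrib)
  \<comment> \<open>The factor \<open>2 * \<i>\<close> left by the cancellation is absorbed by
    rescaling the pair inside the subspace \<open>A\<close>.\<close>
  have half: "(2 * \<i>) *\<^sub>C (1 / (2 * \<i>)) *\<^sub>C b = b" for b :: 'a
    by (simp add: scaleC_scaleC scaleC_one)
  show "range_minus (vn_extension T A) (- \<i>) =
    {r + b | r b. r \<in> range_minus T (- \<i>) \<and> b \<in> Domain A}" (is "?L = ?R")
  proof
    show "?L \<subseteq> ?R"
    proof
      fix x assume "x \<in> ?L"
      then obtain u v where uv: "(u, v) \<in> vn_extension T A" "x = v - (- \<i>) *\<^sub>C u"
        unfolding range_minus_def by blast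
      then obtain f g \<alpha> \<beta> where 1: "(f, g) \<in> T" "(\<alpha>, \<beta>) \<in> A"
        "u = f + \<alpha> - \<beta>" "v = g + \<i> *\<^sub>C \<alpha> + \<i> *\<^sub>C \<beta>" using vn_extensionE by metis
      show "x \<in> ?R" unfolding uv(2) 1(3,4) eqs
        using 1(1) A_scale[OF 1(2), of "2 * \<i>"] unfolding range_minus_def by blast
    qed
    show "?R \<subseteq> ?L"
    proof
      fix x assume "x \<in> ?R"
      then obtain f g b c where 1: "(f, g) \<in> T" "(b, c) \<in> A" "x = (g - (- \<i>) *\<^sub>C f) + b"
        unfolding range_minus_def by blast
      note 2 = A_scale[OF 1(2), of "1 / (2 * \<i>)"]
      have "x = (g - (- \<i>) *\<^sub>C f) + (2 * \<i>) *\<^sub>C (1 / (2 * \<i>)) *\<^sub>C b" unfolding half 1(3) ..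
      then show "x \<in> ?L" unfolding eqs(1)[symmetric, where \<beta> = "(1 / (2 * \<i>)) *\<^sub>C c"]
        using vn_extensionI[OF 1(1) 2 refl refl] unfolding range_minus_def by blast
    qed
  qed
  show "range_minus (vn_extension T A) \<i> =
    {r + b | r b. r \<in> range_minus T \<i> \<and> b \<in> Range A}" (is "?L = ?R")
  proof
    show "?L \<subseteq> ?R"
    proof
      fix x assume "x \<in> ?L"
      then obtain u v where uv: "(u, v) \<in> vn_extension T A" "x = v - \<i> *\<^sub>C u"
        unfolding range_minus_def by blast
      then obtain f g \<alpha> \<beta> where 1: "(f, g) \<in> T" "(\<alpha>, \<beta>) \<in> A"
        "u = f + \<alpha> - \<beta>" "v = g + \<i> *\<^sub>C \<alpha> + \<i> *\<^sub>C \<beta>" using vn_extensionE by metis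
      show "x \<in> ?R" unfolding uv(2) 1(3,4) eqs
        using 1(1) A_scale[OF 1(2), of "2 * \<i>"] unfolding range_minus_def by blast
    qed
    show "?R \<subseteq> ?L"
    proof
      fix x assume "x \<in> ?R"
      then obtain f g b c where 1: "(f, g) \<in> T" "(c, b) \<in> A" "x = (g - \<i> *\<^sub>C f) + b"
        unfolding range_minus_def by blast
      note 2 = A_scale[OF 1(2), of "1 / (2 * \<i>)"]
      have "x = (g - \<i> *\<^sub>C f) + (2 * \<i>) *\<^sub>C (1 / (2 * \<i>)) *\<^sub>C b" unfolding half 1(3) ..
      then show "x \<in> ?L" unfolding eqs(2)[symmetric, where \<alpha> = "(1 / (2 * \<i>)) *\<^sub>C c"]
        using vn_extensionI[OF 1(1) 2 refl refl] unfolding range_minus_def by blast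
    qed
  qed
qed

lemma deficiency_vn_extension:
  "deficiency_subspace K (vn_extension T A) \<i> = deficiency_subspace K T \<i> \<ominus> Domain A"
  "deficiency_subspace K (vn_extension T A) (- \<i>) = deficiency_subspace K T (- \<i>) \<ominus> Range A"
proof -
  have *: "K \<ominus> {r + b | r b. r \<in> R \<and> b \<in> B} = K \<ominus> R \<ominus> B"
    if "0 \<in> R" "0 \<in> B" for R B :: "'a set"
  proof -
    have "(\<forall>r\<in>R. \<forall>b\<in>B. cinner x (r + b) = 0) \<longleftrightarrow>
        (\<forall>r\<in>R. cinner x r = 0) \<and> (\<forall>b\<in>B. cinner x b = 0)" for x
      using that by (auto simp: cinner_add_right) (metis add.right_neutral cinner_zero(2))+
    then show ?thesis unfolding ominus_def by blast
  qed
  show "deficiency_subspace K (vn_extension T A) \<i> = deficiency_subspace K T \<i> \<ominus> Domain A"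
    "deficiency_subspace K (vn_extension T A) (- \<i>) = deficiency_subspace K T (- \<i>) \<ominus> Range A"
    unfolding deficiency_subspace_eq
    by (simp_all add: range_minus_vn_extension * csubspaceD(1) csubspace_range_minus csubspace_T
        csubspace_Domain_A csubspace_Range_A)
qed

lemma Domain_A_orth: "b \<in> Domain A \<Longrightarrow> r \<in> range_minus T (- \<i>) \<Longrightarrow> cinner b r = 0"
  and Range_A_orth: "b \<in> Range A \<Longrightarrow> r \<in> range_minus T \<i> \<Longrightarrow> cinner b r = 0"
  using A_sub unfolding deficiency_subspace_eq ominus_def by auto

text \<open>Closedness of the graph can be tested on either shifted range, where the summand from
  \<open>T\<close> is closed and orthogonal to the one from \<open>A\<close>.\<close>

lemma closed_vn_extension_iff:
  "closed_operator (vn_extension T A) \<longleftrightarrow> closed_csubspace (Domain A)"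
  "closed_operator (vn_extension T A) \<longleftrightarrow> closed_csubspace (Range A)"
proof -
  have "closed (vn_extension T A) \<longleftrightarrow> closed (range_minus (vn_extension T A) (- \<i>))"
    using ext.closed_range_minus_iff[of "- \<i>"] by simp
  also have "\<dots> \<longleftrightarrow> closed (Domain A)"
    unfolding range_minus_vn_extension
    by (intro closed_orthogonal_sum_iff closed_csubspace_range_minus closed_T csubspace_Domain_A
        Domain_A_orth) simp
  finally show "closed_operator (vn_extension T A) \<longleftrightarrow> closed_csubspace (Domain A)"
    by (simp add: ext.closed_operator_iff closed_csubspace_def csubspace_Domain_A)
  have "closed (vn_extension T A) \<longleftrightarrow> closed (range_minus (vn_extension T A) \<i>)"
    using ext.closed_range_minus_iff[of "\<i>"] by simp
  also have "\<dots> \<longleftrightarrow> closed (Range A)"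
    unfolding range_minus_vn_extension
    by (intro closed_orthogonal_sum_iff closed_csubspace_range_minus closed_T csubspace_Range_A
        Range_A_orth) simp
  finally show "closed_operator (vn_extension T A) \<longleftrightarrow> closed_csubspace (Range A)"
    by (simp add: ext.closed_operator_iff closed_csubspace_def csubspace_Range_A)
qed

lemma selfadjoint_vn_extension_iff:
  "selfadjoint_in K (vn_extension T A) \<longleftrightarrow>
    Domain A = deficiency_subspace K T \<i> \<and> Range A = deficiency_subspace K T (- \<i>)"
proof -
  \<comment> \<open>Used at both shifts, where \<open>K \<ominus> R\<close> is a deficiency subspace
    of \<open>T\<close>.\<close>
  have *: "{r + b | r b. r \<in> R \<and> b \<in> B} = K \<longleftrightarrow> B = K \<ominus> R"
    if R: "closed_csubspace R" and RK: "R \<subseteq> K" and B: "csubspace B"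
      and orth: "\<And>b r. b \<in> B \<Longrightarrow> r \<in> R \<Longrightarrow> cinner b r = 0" for R B :: "'a set"
  proof
    assume "{r + b | r b. r \<in> R \<and> b \<in> B} = K"
    then show "B = K \<ominus> R" using orthogonal_sum_ominus[OF R B orth] by simp
  next
    assume BK: "B = K \<ominus> R"
    show "{r + b | r b. r \<in> R \<and> b \<in> B} = K"
    proof safe
      fix r b assume "r \<in> R" "b \<in> B"
      then show "r + b \<in> K" using RK BK by (auto simp: ominus_def intro!: csubspaceD csubspace_K)
    next
      fix x assume x: "x \<in> K"
      have "x - proj R x \<in> K" using x RK proj_in[OF R, of x] by (auto intro!: csubspaceD csubspace_K)
      then have "x - proj R x \<in> B" using proj_orth[OF R] by (simp add: BK ominus_def)
      then show "\<exists>r b. x = r + b \<and> r \<in> R \<and> b \<in> B"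
        using proj_in[OF R, of x]
        by (intro exI[of _ "proj R x"] exI[of _ "x - proj R x"]) simp
    qed
  qed
  have "range_minus (vn_extension T A) (- \<i>) = K \<longleftrightarrow> Domain A = K \<ominus> range_minus T (- \<i>)"
    unfolding range_minus_vn_extension
    by (intro * closed_csubspace_range_minus closed_T range_minus_sub csubspace_Domain_A
        Domain_A_orth) simp
  moreover have "range_minus (vn_extension T A) \<i> = K \<longleftrightarrow> Range A = K \<ominus> range_minus T \<i>"
    unfolding range_minus_vn_extension
    by (intro * closed_csubspace_range_minus closed_T range_minus_sub csubspace_Range_A
        Range_A_orth) simp
  ultimately show ?thesis
    by (simp add: ext.selfadjoint_in_iff deficiency_subspace_eq)
qed

end

subsection \<open>Deficiency and semi-deficiency subspaces\<close>

locale regular_relation =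
  fixes S :: "'a :: complex_hilbert graph"
  assumes regular: "regular_symmetric S"
begin

sublocale symmetric_relation S
  using regular
  by unfold_locales (auto simp: regular_symmetric_def symmetric_operator_def linear_operator_def)

lemma closed_S: "closed S" and single_valued_S: "single_valued S"
  using regular by (auto simp: regular_symmetric_def closed_operator_def linear_operator_def)

lemma csubspace_Domain: "csubspace (Domain S)"
  using T_zero by (intro complex_vector.subspaceI) (auto intro: T_add T_scale)

lemma closed_csubspace_H0: "closed_csubspace (H0 S)"
  by (simp add: H0_def closed_csubspace_def closure_csubspace csubspace_Domain)

lemma csubspace_H0: "csubspace (H0 S)"
  using closed_csubspace_H0 by (simp add: closed_csubspace_def)

lemma Domain_subset_H0: "Domain S \<subseteq> H0 S"
  by (simp add: H0_def closure_subset)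

lemma in_H0: "(f, g) \<in> S \<Longrightarrow> f \<in> H0 S"
  using Domain_subset_H0 by blast

lemma closed_csubspace_LL: "closed_csubspace (LL S)"
  by (simp add: LL_def closed_csubspace_ominus closed_csubspace_UNIV)

lemma csubspace_LL: "csubspace (LL S)"
  using closed_csubspace_LL by (simp add: closed_csubspace_def)

lemma H0_iff: "x \<in> H0 S \<longleftrightarrow> (\<forall>h\<in>LL S. cinner x h = 0)"
proof -
  have "UNIV \<ominus> LL S = H0 S"
    unfolding LL_def by (rule ominus_ominus[OF closed_csubspace_H0 complex_vector.subspace_UNIV]) simp
  then show ?thesis by (auto simp: ominus_def)
qed

lemma LL_orth: "h \<in> LL S \<Longrightarrow> x \<in> H0 S \<Longrightarrow> cinner x h = 0"
  and LL_orth': "h \<in> LL S \<Longrightarrow> x \<in> H0 S \<Longrightarrow> cinner h x = 0"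
  using H0_iff cinner_eq_0_commute by blast+

lemma LL_I:
  assumes "\<And>f g. (f, g) \<in> S \<Longrightarrow> cinner h f = 0"
  shows "h \<in> LL S"
proof -
  have "closed {y. cinner h y = 0}"
    by (intro closed_Collect_eq continuous_on_cinner continuous_intros)
  then have "H0 S \<subseteq> {y. cinner h y = 0}"
    unfolding H0_def using assms by (intro closure_minimal) auto
  then show ?thesis by (auto simp: LL_def ominus_def)
qed

lemma proj_H0_LL: "h \<in> LL S \<Longrightarrow> proj (H0 S) h = 0"
  by (rule proj_eq_0[OF closed_csubspace_H0]) (rule LL_orth')

definition S0 :: "'a graph" where "S0 = compression (H0 S) S"

lemma S0_eq: "S0 = {(f, proj (H0 S) g) | f g. (f, g) \<in> S}"
  unfolding S0_def compression_def using in_H0 by blast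

sublocale S0: closed_dense_symmetric S0 "H0 S"
proof unfold_locales
  have "closed_operator S0" using regular by (simp add: S0_def regular_symmetric_def)
  then show "csubspace S0" "closed S0" by (simp_all add: closed_operator_def linear_operator_def)
  show "Im (cinner g f) = 0" if "(f, g) \<in> S0" for f g
    using that symmetric by (auto simp: S0_eq cinner_proj_left closed_csubspace_H0 in_H0)
  show "S0 \<subseteq> H0 S \<times> H0 S"
    using proj_in[OF closed_csubspace_H0] in_H0 by (auto simp: S0_eq)
  have "Domain S0 = Domain S" by (auto simp: S0_eq)
  then show "closure (Domain S0) = H0 S" by (simp add: H0_def)
qed

lemma NN_iff: "x \<in> NN S \<mu> \<longleftrightarrow> (\<forall>(f, g)\<in>S. cinner x g = \<mu> * cinner x f)"
  unfolding NN_def deficiency_subspace_iff by simp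

lemma NN_D: "x \<in> NN S \<mu> \<Longrightarrow> (f, g) \<in> S \<Longrightarrow> cinner x g = \<mu> * cinner x f"
  unfolding NN_iff by blast

lemma closed_csubspace_NN: "closed_csubspace (NN S \<mu>)"
  unfolding NN_def by (rule closed_csubspace_deficiency[OF closed_csubspace_UNIV])

lemma csubspace_NN: "csubspace (NN S \<mu>)"
  using closed_csubspace_NN by (simp add: closed_csubspace_def)

lemma deficiency_subspace_S0: "deficiency_subspace (H0 S) S0 \<mu> = NN S \<mu> \<inter> H0 S"
proof -
  have "(\<forall>(f, g)\<in>S0. cinner x g = \<mu> * cinner x f) \<longleftrightarrow> x \<in> NN S \<mu>" if "x \<in> H0 S" for x
  proof -
    have "(\<forall>(f, g)\<in>S0. cinner x g = \<mu> * cinner x f) \<longleftrightarrow>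
        (\<forall>(f, g)\<in>S. cinner x (proj (H0 S) g) = \<mu> * cinner x f)"
      unfolding S0_eq by blast
    then show ?thesis unfolding NN_iff cinner_proj_right[OF closed_csubspace_H0 that] .
  qed
  then show ?thesis unfolding deficiency_subspace_iff set_eq_iff by blast
qed

text \<open>A vector of \<open>NN S \<mu>\<close> pairs with \<open>h\<close> as with the projection
  of \<open>h\<close>, so orthogonality to \<open>LL_at S \<mu>\<close> is orthogonality to
  \<open>LL S\<close>.\<close>

lemma NN'_eq: "NN' S \<mu> = NN S \<mu> \<inter> H0 S"
  by (auto simp: NN'_def LL_at_def ominus_def H0_iff cinner_proj_right closed_csubspace_NN)

lemma NN'_eq_deficiency: "NN' S \<mu> = deficiency_subspace (H0 S) S0 \<mu>"
  by (simp add: NN'_eq deficiency_subspace_S0)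

lemma closed_csubspace_NN': "closed_csubspace (NN' S \<mu>)"
  unfolding NN'_eq_deficiency by (rule closed_csubspace_deficiency[OF closed_csubspace_H0])

section \<open>Projections of \<open>LL S\<close> onto the two deficiency subspaces\<close>

lemma imaginary_unit:
  assumes "\<mu> = \<i> \<or> \<mu> = - \<i>"
  shows "cnj \<mu> = - \<mu>" "\<mu> \<noteq> 0" "Im \<mu> \<noteq> 0" "- \<mu> = \<i> \<or> - \<mu> = - \<i>"
  using assms by auto

text \<open>The complement of \<open>NN S \<mu>\<close> is the closed range of
  \<open>S + \<mu>\<close>, which yields \<open>(f, g)\<close>. As \<open>h\<close> is orthogonal to
  \<open>Domain S\<close>, flipping the sign of \<open>\<mu> *\<^sub>C f\<close> gives the
  projection for \<open>- \<mu>\<close>.\<close>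

lemma LL_projection_graph:
  assumes \<mu>: "\<mu> = \<i> \<or> \<mu> = - \<i>" and h: "h \<in> LL S"
  obtains f g where "(f, g) \<in> S" "proj (NN S \<mu>) h = h - g - \<mu> *\<^sub>C f"
    "proj (NN S (- \<mu>)) h = h - g + \<mu> *\<^sub>C f"
proof -
  note \<mu>' = imaginary_unit[OF \<mu>]
  have "closed_csubspace (range_minus S (- \<mu>))"
    using closed_csubspace_range_minus[OF closed_S] \<mu>'(3) by simp
  from ominus_ominus[OF this complex_vector.subspace_UNIV]
  have "UNIV \<ominus> NN S \<mu> = range_minus S (- \<mu>)"
    by (simp add: NN_def deficiency_subspace_eq \<mu>'(1))
  moreover have "h - proj (NN S \<mu>) h \<in> UNIV \<ominus> NN S \<mu>"
    using proj_orth[OF closed_csubspace_NN] by (simp add: ominus_def)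
  ultimately obtain f g where fg: "(f, g) \<in> S" "h - proj (NN S \<mu>) h = g - (- \<mu>) *\<^sub>C f"
    unfolding range_minus_def by blast
  have \<phi>: "proj (NN S \<mu>) h = h - g - \<mu> *\<^sub>C f" using fg(2) by (simp add: algebra_simps)
  have "proj (NN S (- \<mu>)) h = h - g + \<mu> *\<^sub>C f"
  proof (rule proj_unique[OF closed_csubspace_NN])
    show "h - g + \<mu> *\<^sub>C f \<in> NN S (- \<mu>)"
      unfolding NN_iff
    proof safe
      fix f' g' assume fg': "(f', g') \<in> S"
      have "cinner (h - g - \<mu> *\<^sub>C f) g' = \<mu> * cinner (h - g - \<mu> *\<^sub>C f) f'"
        using NN_D[OF proj_in[OF closed_csubspace_NN] fg', of \<mu> h] unfolding \<phi> .
      moreover have "cinner h f' = 0" using LL_orth'[OF h in_H0[OF fg']] .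
      moreover have "cinner g f' = cinner f g'" by (rule symmetric_polar[OF fg(1) fg'])
      ultimately show "cinner (h - g + \<mu> *\<^sub>C f) g' = - \<mu> * cinner (h - g + \<mu> *\<^sub>C f) f'"
        by (simp add: cinner_simps algebra_simps)
    qed
    fix z assume "z \<in> NN S (- \<mu>)"
    then have "cinner z (h - (h - g + \<mu> *\<^sub>C f)) = 0"
      using NN_D[OF _ fg(1)] by (simp add: cinner_simps \<mu>'(1))
    then show "cinner (h - (h - g + \<mu> *\<^sub>C f)) z = 0" using cinner_eq_0_commute by blast
  qed
  then show thesis using that fg(1) \<phi> by blast
qed

text \<open>The two projections of \<open>h\<close> differ by a multiple of some
  \<open>f \<in> Domain S\<close>, to which \<open>h'\<close> is orthogonal. This is the isometry of
  \<open>VV\<close>, stated before \<open>VV\<close> is known to be well defined.\<close>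

lemma cinner_proj_NN:
  assumes \<mu>: "\<mu> = \<i> \<or> \<mu> = - \<i>" and h: "h \<in> LL S" "h' \<in> LL S"
  shows "cinner (proj (NN S \<mu>) h) (proj (NN S \<mu>) h') =
    cinner (proj (NN S (- \<mu>)) h) (proj (NN S (- \<mu>)) h')"
proof -
  obtain f g where fg: "(f, g) \<in> S" "proj (NN S \<mu>) h = h - g - \<mu> *\<^sub>C f"
    "proj (NN S (- \<mu>)) h = h - g + \<mu> *\<^sub>C f"
    by (rule LL_projection_graph[OF \<mu> h(1)])
  have "cinner f h' = 0" using LL_orth[OF h(2) in_H0[OF fg(1)]] .
  then have "cinner (proj (NN S \<mu>) h) h' = cinner (proj (NN S (- \<mu>)) h) h'"
    unfolding fg by (simp add: cinner_simps)
  then show ?thesis by (simp add: cinner_proj_right closed_csubspace_NN proj_in)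
qed

text \<open>If the difference projects to zero at \<open>\<mu>\<close>, the isometry makes it
  project to zero at \<open>- \<mu>\<close>; comparing the two representations gives
  \<open>f = 0\<close>, and \<open>g = 0\<close> because \<open>S\<close> is single-valued.\<close>

lemma proj_NN_inj:
  assumes \<mu>: "\<mu> = \<i> \<or> \<mu> = - \<i>" and h: "h \<in> LL S" "h' \<in> LL S"
    and eq: "proj (NN S \<mu>) h = proj (NN S \<mu>) h'"
  shows "h = h'"
proof -
  have d: "h - h' \<in> LL S" using h by (intro csubspaceD csubspace_LL)
  obtain f g where fg: "(f, g) \<in> S" "proj (NN S \<mu>) (h - h') = h - h' - g - \<mu> *\<^sub>C f"
    "proj (NN S (- \<mu>)) (h - h') = h - h' - g + \<mu> *\<^sub>C f"
    by (rule LL_projection_graph[OF \<mu> d])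
  have zero: "proj (NN S \<mu>) (h - h') = 0" by (simp add: proj_diff closed_csubspace_NN eq)
  then have zero': "proj (NN S (- \<mu>)) (h - h') = 0" using cinner_proj_NN[OF \<mu> d d] by simp
  have *: "h - h' - g = \<mu> *\<^sub>C f" "h - h' - g + \<mu> *\<^sub>C f = 0"
    using fg(2) fg(3) unfolding zero zero' by simp_all
  then have "(\<mu> + \<mu>) *\<^sub>C f = 0" unfolding scaleC_add_left by simp
  then have "f = 0" using imaginary_unit(2)[OF \<mu>] by simp
  then have "g = 0" using fg(1) T_zero single_valued_S single_valuedD by metis
  then show ?thesis using * \<open>f = 0\<close> by simp
qed

lemma VV_proj_NN:
  assumes \<mu>: "\<mu> = \<i> \<or> \<mu> = - \<i>" and h: "h \<in> LL S"
  shows "VV S \<mu> (proj (NN S \<mu>) h) = proj (NN S (- \<mu>)) h"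
proof -
  have "(THE k. k \<in> LL S \<and> proj (NN S \<mu>) k = proj (NN S \<mu>) h) = h"
    using h proj_NN_inj[OF \<mu>] by (intro the_equality) auto
  then show ?thesis by (simp add: VV_def imaginary_unit(1)[OF \<mu>])
qed

text \<open>A converse to \<open>LL_projection_graph\<close>: it recognises pairs in the graph of
  \<open>VV\<close> by their difference alone.\<close>

lemma diff_in_Domain_imp_proj:
  assumes \<mu>: "\<mu> = \<i> \<or> \<mu> = - \<i>" and "\<phi> \<in> NN S \<mu>" "\<psi> \<in> NN S (- \<mu>)" "\<phi> - \<psi> \<in> Domain S"
  obtains h where "h \<in> LL S" "\<phi> = proj (NN S \<mu>) h" "\<psi> = proj (NN S (- \<mu>)) h"
proof -
  note \<mu>' = imaginary_unit[OF \<mu>]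
  obtain g where fg: "(\<phi> - \<psi>, g) \<in> S" using assms(4) by blast
  \<comment> \<open>The value of \<open>S\<close> at \<open>\<phi> - \<psi>\<close> minus
    \<open>\<mu> *\<^sub>C \<phi> + \<mu> *\<^sub>C \<psi>\<close>, the value that the weak
    eigenvalue equations assign to it. Both agree when tested on \<open>Domain S\<close>, so
    \<open>k\<close> is in \<open>LL S\<close>.\<close>
  define k where "k = g - \<mu> *\<^sub>C \<phi> - \<mu> *\<^sub>C \<psi>"
  \<comment> \<open>Removes the factor \<open>- 2 * \<mu>\<close> with which \<open>k\<close>
    projects to \<open>\<phi>\<close> and \<open>\<psi>\<close>.\<close>
  define c where "c = - 1 / (2 * \<mu>)"
  have c: "c * (- 2 * \<mu>) = 1" using \<mu>'(2) by (simp add: c_def)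
  have k: "k \<in> LL S"
  proof (rule LL_I)
    fix f' g' assume fg': "(f', g') \<in> S"
    show "cinner k f' = 0"
      using symmetric_polar[OF fg fg'] NN_D[OF assms(2) fg'] NN_D[OF assms(3) fg']
      by (simp add: k_def cinner_simps)
  qed
  have "proj (NN S \<mu>) k = (- 2 * \<mu>) *\<^sub>C \<phi>"
  proof (rule proj_unique[OF closed_csubspace_NN])
    show "(- 2 * \<mu>) *\<^sub>C \<phi> \<in> NN S \<mu>" using assms(2) by (intro csubspaceD csubspace_NN)
    fix z assume z: "z \<in> NN S \<mu>"
    have "cinner z (k - (- 2 * \<mu>) *\<^sub>C \<phi>) = 0"
      using NN_D[OF z fg] by (simp add: k_def cinner_simps \<mu>'(1) algebra_simps)
    then show "cinner (k - (- 2 * \<mu>) *\<^sub>C \<phi>) z = 0" using cinner_eq_0_commute by blast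
  qed
  then have 1: "\<phi> = proj (NN S \<mu>) (c *\<^sub>C k)"
    using c by (simp add: proj_scaleC closed_csubspace_NN scaleC_scaleC scaleC_one
        del: complex_vector.scale_minus_left mult_minus_left)
  have "proj (NN S (- \<mu>)) k = (- 2 * \<mu>) *\<^sub>C \<psi>"
  proof (rule proj_unique[OF closed_csubspace_NN])
    show "(- 2 * \<mu>) *\<^sub>C \<psi> \<in> NN S (- \<mu>)" using assms(3) by (intro csubspaceD csubspace_NN)
    fix z assume z: "z \<in> NN S (- \<mu>)"
    have "cinner z (k - (- 2 * \<mu>) *\<^sub>C \<psi>) = 0"
      using NN_D[OF z fg] by (simp add: k_def cinner_simps \<mu>'(1) algebra_simps)
    then show "cinner (k - (- 2 * \<mu>) *\<^sub>C \<psi>) z = 0" using cinner_eq_0_commute by blast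
  qed
  then have 2: "\<psi> = proj (NN S (- \<mu>)) (c *\<^sub>C k)"
    using c by (simp add: proj_scaleC closed_csubspace_NN scaleC_scaleC scaleC_one
        del: complex_vector.scale_minus_left mult_minus_left)
  show thesis using that[OF csubspaceD(4)[OF csubspace_LL k] 1 2] .
qed

text \<open>This is where regularity enters: the range on the right is closed because
  \<^term>\<open>S0\<close> is.\<close>

lemma LL_at_eq:
  assumes \<mu>: "\<mu> = \<i> \<or> \<mu> = - \<i>"
  shows "LL_at S \<mu> = {x \<in> NN S \<mu>. proj (H0 S) x \<in> range_minus S0 (- \<mu>)}"
proof
  show "LL_at S \<mu> \<subseteq> {x \<in> NN S \<mu>. proj (H0 S) x \<in> range_minus S0 (- \<mu>)}"
  proof
    fix x assume "x \<in> LL_at S \<mu>"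
    then obtain h where h: "h \<in> LL S" "x = proj (NN S \<mu>) h" by (auto simp: LL_at_def)
    obtain f g where fg: "(f, g) \<in> S" "proj (NN S \<mu>) h = h - g - \<mu> *\<^sub>C f"
      by (rule LL_projection_graph[OF \<mu> h(1)])
    have "proj (H0 S) x = proj (H0 S) (- g) - (- \<mu>) *\<^sub>C (- f)"
      using proj_ident[OF closed_csubspace_H0 in_H0[OF fg(1)]]
      by (simp add: h(2) fg(2) proj_minus proj_diff proj_scaleC
          closed_csubspace_H0 proj_H0_LL h(1))
    moreover have "(- f, - g) \<in> S" using T_scale[OF fg(1), of "- 1"] by (simp add: scaleC_one)
    ultimately have "proj (H0 S) x \<in> range_minus S0 (- \<mu>)"
      unfolding range_minus_def S0_eq by blast
    then show "x \<in> {x \<in> NN S \<mu>. proj (H0 S) x \<in> range_minus S0 (- \<mu>)}"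
      using h(2) proj_in[OF closed_csubspace_NN] by simp
  qed
  show "{x \<in> NN S \<mu>. proj (H0 S) x \<in> range_minus S0 (- \<mu>)} \<subseteq> LL_at S \<mu>"
  proof safe
    fix x assume x: "x \<in> NN S \<mu>" "proj (H0 S) x \<in> range_minus S0 (- \<mu>)"
    then obtain f g where fg: "(f, g) \<in> S" "proj (H0 S) x = proj (H0 S) g - (- \<mu>) *\<^sub>C f"
      unfolding range_minus_def S0_eq by blast
    \<comment> \<open>Subtracting an element of the range of \<open>S + \<mu>\<close> cancels the
      component in \<open>H0 S\<close> and leaves the projection onto \<open>NN S \<mu>\<close>
      unchanged, since that range is orthogonal to it.\<close>
    define h where "h = x - (g + \<mu> *\<^sub>C f)"
    have "proj (H0 S) h = 0"
      using fg(2) proj_ident[OF closed_csubspace_H0 in_H0[OF fg(1)]]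
      by (simp add: h_def proj_diff proj_add proj_scaleC closed_csubspace_H0)
    then have "cinner h y = 0" if "y \<in> H0 S" for y
      using cinner_proj_left[OF closed_csubspace_H0 that, of h] by simp
    then have h: "h \<in> LL S" by (simp add: LL_def ominus_def)
    have "proj (NN S \<mu>) h = x"
    proof (rule proj_unique[OF closed_csubspace_NN x(1)])
      fix z assume z: "z \<in> NN S \<mu>"
      have "cinner z (h - x) = 0"
        using NN_D[OF z fg(1)] by (simp add: h_def cinner_simps imaginary_unit(1)[OF \<mu>])
      then show "cinner (h - x) z = 0" using cinner_eq_0_commute by blast
    qed
    then show "x \<in> LL_at S \<mu>" using h by (auto simp: LL_at_def)
  qed
qed

text \<open>By \<open>LL_at_eq\<close> this is the part of \<open>NN S \<mu>\<close> that the
  bounded map \<open>proj (H0 S)\<close> sends into a closed range.\<close>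

lemma closed_csubspace_LL_at:
  assumes \<mu>: "\<mu> = \<i> \<or> \<mu> = - \<i>"
  shows "closed_csubspace (LL_at S \<mu>)"
proof -
  have R: "closed_csubspace (range_minus S0 (- \<mu>))"
    using S0.closed_csubspace_range_minus[OF S0.closed_T] imaginary_unit(3)[OF \<mu>] by simp
  have eq: "LL_at S \<mu> = NN S \<mu> \<inter> proj (H0 S) -` range_minus S0 (- \<mu>)"
    using LL_at_eq[OF \<mu>] by auto
  have "closed (proj (H0 S) -` range_minus S0 (- \<mu>))"
  proof (rule continuous_closed_vimage)
    show "closed (range_minus S0 (- \<mu>))" using R by (simp add: closed_csubspace_def)
    show "isCont (proj (H0 S)) x" for x
      by (rule linear_continuous_at[OF bounded_linear_proj[OF closed_csubspace_H0]])
  qed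
  moreover have "csubspace (LL_at S \<mu>)"
  proof (rule complex_vector.subspaceI)
    note N = csubspaceD[OF csubspace_NN[of \<mu>]]
      and R' = csubspaceD[OF conjunct1[OF R[unfolded closed_csubspace_def]]]
    show "0 \<in> LL_at S \<mu>"
      unfolding eq by (simp add: N(1) R'(1) proj_zero closed_csubspace_H0)
    show "x + y \<in> LL_at S \<mu>" if "x \<in> LL_at S \<mu>" "y \<in> LL_at S \<mu>" for x y
      using that unfolding eq by (simp add: N(2) R'(2) proj_add closed_csubspace_H0)
    show "c *\<^sub>C x \<in> LL_at S \<mu>" if "x \<in> LL_at S \<mu>" for c x
      using that unfolding eq by (simp add: N(4) R'(4) proj_scaleC closed_csubspace_H0)
  qed
  ultimately show ?thesis
    using closed_csubspace_NN[of \<mu>] by (auto simp: closed_csubspace_def eq)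
qed

section \<open>The semi-deficiency decomposition and the kernel\<close>

lemma LL_at_subset: "LL_at S \<mu> \<subseteq> NN S \<mu>"
  using proj_in[OF closed_csubspace_NN] by (auto simp: LL_at_def)

lemma NN_decompose:
  assumes \<mu>: "\<mu> = \<i> \<or> \<mu> = - \<i>" and \<phi>: "\<phi> \<in> NN S \<mu>"
  shows "\<phi> = proj (NN' S \<mu>) \<phi> + proj (LL_at S \<mu>) \<phi>"
proof -
  have "proj (NN' S \<mu>) \<phi> = \<phi> - proj (LL_at S \<mu>) \<phi>"
  proof (rule proj_unique[OF closed_csubspace_NN'])
    show "\<phi> - proj (LL_at S \<mu>) \<phi> \<in> NN' S \<mu>"
      using \<phi> proj_in[OF closed_csubspace_LL_at[OF \<mu>], of \<phi>] LL_at_subset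
        proj_orth[OF closed_csubspace_LL_at[OF \<mu>], of _ \<phi>]
      unfolding NN'_def ominus_def by (auto intro!: csubspaceD csubspace_NN)
    fix z assume "z \<in> NN' S \<mu>"
    then have "cinner z (proj (LL_at S \<mu>) \<phi>) = 0"
      using proj_in[OF closed_csubspace_LL_at[OF \<mu>], of \<phi>] by (simp add: NN'_def ominus_def)
    then show "cinner (\<phi> - (\<phi> - proj (LL_at S \<mu>) \<phi>)) z = 0"
      using cinner_eq_0_commute by auto
  qed
  then show ?thesis by simp
qed

lemma norm_NN_decompose:
  assumes \<mu>: "\<mu> = \<i> \<or> \<mu> = - \<i>" and \<phi>: "\<phi> \<in> NN S \<mu>"
  shows "(norm \<phi>)\<^sup>2 = (norm (proj (NN' S \<mu>) \<phi>))\<^sup>2 + (norm (proj (LL_at S \<mu>) \<phi>))\<^sup>2"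
proof -
  have "cinner (proj (NN' S \<mu>) \<phi>) (proj (LL_at S \<mu>) \<phi>) = 0"
    using proj_in[OF closed_csubspace_NN', of \<mu> \<phi>] proj_in[OF closed_csubspace_LL_at[OF \<mu>], of \<phi>]
    by (simp add: NN'_def ominus_def)
  then have "inner (proj (NN' S \<mu>) \<phi>) (proj (LL_at S \<mu>) \<phi>) = 0" by (metis Re_cinner zero_complex.sel(1))
  then have "(norm (proj (NN' S \<mu>) \<phi> + proj (LL_at S \<mu>) \<phi>))\<^sup>2 =
      (norm (proj (NN' S \<mu>) \<phi>))\<^sup>2 + (norm (proj (LL_at S \<mu>) \<phi>))\<^sup>2"
    unfolding power2_norm_eq_inner by (simp add: inner_add inner_commute)
  then show ?thesis using NN_decompose[OF \<mu> \<phi>] by simp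
qed

text \<open>Pairing \<open>\<phi> - W \<phi>\<close> with \<open>h \<in> LL S\<close> sees only the
  \<open>LL_at\<close> parts, and the isometry moves the part of \<open>\<phi>\<close> to the side
  of \<open>- \<mu>\<close>. There the pairing is that of \<open>- d\<close> with the projection of
  \<open>h\<close>, where \<open>d\<close> is the vector whose vanishing defines the kernel.
  \<open>W\<close> stands for \<open>U\<close> and for its inverse.\<close>

lemma ker_at_eq:
  assumes \<mu>: "\<mu> = \<i> \<or> \<mu> = - \<i>" and W: "W ` NN S \<mu> \<subseteq> NN S (- \<mu>)"
  shows "ker_at S \<mu> W = {\<phi> \<in> NN S \<mu>. \<phi> - W \<phi> \<in> H0 S}"
proof -
  have "proj (LL_at S (- \<mu>)) (W \<phi>) - VV S \<mu> (proj (LL_at S \<mu>) \<phi>) = 0 \<longleftrightarrow> \<phi> - W \<phi> \<in> H0 S"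
    if \<phi>: "\<phi> \<in> NN S \<mu>" for \<phi>
  proof -
    note L = closed_csubspace_LL_at[OF \<mu>] closed_csubspace_LL_at[OF imaginary_unit(4)[OF \<mu>]]
    obtain k where k: "k \<in> LL S" "proj (LL_at S \<mu>) \<phi> = proj (NN S \<mu>) k"
      using proj_in[OF L(1), of \<phi>] by (auto simp: LL_at_def)
    define d where "d = proj (LL_at S (- \<mu>)) (W \<phi>) - proj (NN S (- \<mu>)) k"
    have d: "d \<in> LL_at S (- \<mu>)"
      using proj_in[OF L(2)] k(1) L(2) unfolding d_def closed_csubspace_def
      by (intro csubspaceD) (auto simp: LL_at_def)
    have cd: "cinner (\<phi> - W \<phi>) h = - cinner d (proj (NN S (- \<mu>)) h)" if h: "h \<in> LL S" for h
    proof -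
      have mem: "proj (NN S \<mu>) h \<in> LL_at S \<mu>" "proj (NN S (- \<mu>)) h \<in> LL_at S (- \<mu>)"
        using h by (auto simp: LL_at_def)
      have "cinner \<phi> h = cinner (proj (NN S \<mu>) k) (proj (NN S \<mu>) h)"
        using cinner_proj_right[OF closed_csubspace_NN \<phi>, of h] cinner_proj_left[OF L(1) mem(1), of \<phi>]
        by (simp add: k(2))
      then have "cinner \<phi> h = cinner (proj (NN S (- \<mu>)) k) (proj (NN S (- \<mu>)) h)"
        using cinner_proj_NN[OF \<mu> k(1) h] by simp
      moreover have "cinner (W \<phi>) h = cinner (proj (LL_at S (- \<mu>)) (W \<phi>)) (proj (NN S (- \<mu>)) h)"
        using cinner_proj_right[OF closed_csubspace_NN, of "W \<phi>" "- \<mu>" h] W \<phi>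
          cinner_proj_left[OF L(2) mem(2), of "W \<phi>"] by auto
      ultimately show ?thesis by (simp add: d_def cinner_diff_left)
    qed
    have "\<phi> - W \<phi> \<in> H0 S \<longleftrightarrow> (\<forall>y\<in>LL_at S (- \<mu>). cinner d y = 0)"
      unfolding H0_iff LL_at_def using cd by auto
    also have "\<dots> \<longleftrightarrow> d = 0" using d by (metis cinner_self_eq_0 cinner_zero(1))
    finally show ?thesis by (simp add: d_def k VV_proj_NN[OF \<mu>])
  qed
  then show ?thesis unfolding ker_at_def imaginary_unit(1)[OF \<mu>] by blast
qed

text \<open>The \<open>LL_at\<close> parts of \<open>\<phi>\<close> and \<open>W \<phi>\<close> are
  the two projections of one \<open>k \<in> LL S\<close>, so both are expressed by one pair of
  \<open>S\<close>. Trading them for a multiple of this pair matches the arguments and, after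
  projection to \<open>H0 S\<close>, also the values.\<close>

lemma ker_at_split:
  assumes \<mu>: "\<mu> = \<i> \<or> \<mu> = - \<i>" and W: "W ` NN S \<mu> \<subseteq> NN S (- \<mu>)" and \<phi>: "\<phi> \<in> ker_at S \<mu> W"
  obtains f g where "(f, g) \<in> S"
    "\<phi> - W \<phi> = f + proj (NN' S \<mu>) \<phi> - proj (NN' S (- \<mu>)) (W \<phi>)"
    "proj (H0 S) (\<mu> *\<^sub>C \<phi> + \<mu> *\<^sub>C W \<phi>) =
      proj (H0 S) g + \<mu> *\<^sub>C proj (NN' S \<mu>) \<phi> + \<mu> *\<^sub>C proj (NN' S (- \<mu>)) (W \<phi>)"
    "norm (proj (LL_at S \<mu>) \<phi>) = norm (proj (LL_at S (- \<mu>)) (W \<phi>))"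
proof -
  note \<mu>' = imaginary_unit[OF \<mu>]
  have \<phi>N: "\<phi> \<in> NN S \<mu>" and W\<phi>: "W \<phi> \<in> NN S (- \<mu>)" using \<phi> W by (auto simp: ker_at_def)
  obtain k where k: "k \<in> LL S" "proj (LL_at S \<mu>) \<phi> = proj (NN S \<mu>) k"
    using proj_in[OF closed_csubspace_LL_at[OF \<mu>], of \<phi>] by (auto simp: LL_at_def)
  have k': "proj (LL_at S (- \<mu>)) (W \<phi>) = proj (NN S (- \<mu>)) k"
    using \<phi> by (simp add: ker_at_def \<mu>'(1) k VV_proj_NN[OF \<mu>])
  obtain f g where fg: "(f, g) \<in> S" "proj (NN S \<mu>) k = k - g - \<mu> *\<^sub>C f"
    "proj (NN S (- \<mu>)) k = k - g + \<mu> *\<^sub>C f"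
    by (rule LL_projection_graph[OF \<mu> k(1)])
  \<comment> \<open>Subtracting the two projections of \<open>k\<close> leaves
    \<open>- 2 * \<mu>\<close> times \<open>f\<close>; adding them, multiplying by
    \<open>\<mu>\<close> and projecting leaves the same multiple of the projected
    \<open>g\<close>.\<close>
  define c where "c = - 2 * \<mu>"
  have "c = - \<mu> - \<mu>" by (simp add: c_def)
  then have c: "c *\<^sub>C x = - (\<mu> *\<^sub>C x) - \<mu> *\<^sub>C x" for x :: 'a
    by (simp only: complex_vector.scale_left_diff_distrib complex_vector.scale_minus_left)
  note eqs = NN_decompose[OF \<mu> \<phi>N, unfolded k(2) fg(2)]
    NN_decompose[OF \<mu>'(4) W\<phi>, unfolded k' fg(3)]
  have P: "proj (NN' S \<nu>) x \<in> H0 S" for \<nu> x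
    using proj_in[OF closed_csubspace_NN', of \<nu> x] by (simp add: NN'_eq)
  show thesis
  proof (rule that[OF T_scale[OF fg(1), of c]])
    show "\<phi> - W \<phi> = c *\<^sub>C f + proj (NN' S \<mu>) \<phi> - proj (NN' S (- \<mu>)) (W \<phi>)"
      by (subst (1) eqs(1), subst (1) eqs(2))
        (simp add: c)
    have "proj (H0 S) \<phi> = proj (NN' S \<mu>) \<phi> - proj (H0 S) g - \<mu> *\<^sub>C f"
      by (subst (1) eqs(1)) (simp add: proj_add proj_diff proj_scaleC closed_csubspace_H0
          proj_H0_LL k(1) proj_ident[OF closed_csubspace_H0] P in_H0[OF fg(1)])
    moreover have "proj (H0 S) (W \<phi>) = proj (NN' S (- \<mu>)) (W \<phi>) - proj (H0 S) g + \<mu> *\<^sub>C f"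
      by (subst (1) eqs(2)) (simp add: proj_add proj_diff proj_scaleC closed_csubspace_H0
          proj_H0_LL k(1) proj_ident[OF closed_csubspace_H0] P in_H0[OF fg(1)])
    ultimately show "proj (H0 S) (\<mu> *\<^sub>C \<phi> + \<mu> *\<^sub>C W \<phi>) = proj (H0 S) (c *\<^sub>C g)
        + \<mu> *\<^sub>C proj (NN' S \<mu>) \<phi> + \<mu> *\<^sub>C proj (NN' S (- \<mu>)) (W \<phi>)"
      by (simp add: proj_add proj_diff proj_minus proj_scaleC closed_csubspace_H0 c scaleC_add_right
          complex_vector.scale_right_diff_distrib)
    have "(norm (proj (NN S \<mu>) k))\<^sup>2 = (norm (proj (NN S (- \<mu>)) k))\<^sup>2"
      using cinner_proj_NN[OF \<mu> k(1) k(1)] by (simp only: cinner_self of_real_eq_iff)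
    then show "norm (proj (LL_at S \<mu>) \<phi>) = norm (proj (LL_at S (- \<mu>)) (W \<phi>))"
      by (simp add: k k')
  qed
qed

end

subsection \<open>The selfadjoint extension and its compression\<close>

locale admissible_extension = regular_relation S for S :: "'a :: complex_hilbert graph" +
  fixes U :: "'a \<Rightarrow> 'a"
  assumes admissible: "admissible S U"
begin

abbreviation "K \<equiv> ker_at S \<i> U"
abbreviation "K' \<equiv> ker_at S (- \<i>) (U_inv S U)"
abbreviation "P \<equiv> proj (NN' S \<i>)"
abbreviation "Q \<equiv> proj (NN' S (- \<i>))"

lemma U_add: "x \<in> NN S \<i> \<Longrightarrow> y \<in> NN S \<i> \<Longrightarrow> U (x + y) = U x + U y"
  and U_scale: "x \<in> NN S \<i> \<Longrightarrow> U (c *\<^sub>C x) = c *\<^sub>C U x"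
  and U_isometry: "x \<in> NN S \<i> \<Longrightarrow> y \<in> NN S \<i> \<Longrightarrow> cinner (U x) (U y) = cinner x y"
  and U_image: "U ` NN S \<i> = NN S (- \<i>)"
  using admissible unfolding admissible_def unitary_onto_def by blast+

lemma U_in: "x \<in> NN S \<i> \<Longrightarrow> U x \<in> NN S (- \<i>)"
  using U_image by blast

lemma norm_U: "x \<in> NN S \<i> \<Longrightarrow> norm (U x) = norm x"
  using U_isometry[of x x] unfolding cinner_self of_real_eq_iff by simp

lemma U_zero: "U 0 = 0"
  using norm_U[OF csubspaceD(1)[OF csubspace_NN]] by simp

lemma U_minus: "x \<in> NN S \<i> \<Longrightarrow> U (- x) = - U x"
  using U_scale[of x "- 1"] by (simp add: scaleC_one)

lemma inj_on_U: "inj_on U (NN S \<i>)"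
proof (rule inj_onI)
  fix x y assume xy: "x \<in> NN S \<i>" "y \<in> NN S \<i>" "U x = U y"
  have "x - y \<in> NN S \<i>" using xy by (intro csubspaceD csubspace_NN)
  moreover have "U (x - y) = 0"
    using U_add[OF xy(1) csubspaceD(5)[OF csubspace_NN xy(2)]] U_minus[OF xy(2)] xy(3) by simp
  ultimately show "x = y" using norm_U[of "x - y"] by simp
qed

lemma U_inv_U: "x \<in> NN S \<i> \<Longrightarrow> U_inv S U (U x) = x"
  unfolding U_inv_def by (rule inv_into_f_f[OF inj_on_U])

lemma K_eq: "K = {\<phi> \<in> NN S \<i>. \<phi> - U \<phi> \<in> H0 S}"
  by (rule ker_at_eq) (simp_all add: U_image)

text \<open>At \<open>U \<phi>\<close> the condition for the inverse is the condition on
  \<open>\<phi> - U \<phi>\<close> up to sign.\<close>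

lemma K'_eq: "K' = U ` K"
proof -
  have "K' = {\<psi> \<in> NN S (- \<i>). \<psi> - U_inv S U \<psi> \<in> H0 S}"
    by (rule ker_at_eq) (auto simp: U_image[symmetric] U_inv_U)
  also have "\<dots> = {U \<phi> | \<phi>. \<phi> \<in> NN S \<i> \<and> U \<phi> - \<phi> \<in> H0 S}"
    unfolding U_image[symmetric] by (auto simp: U_inv_U)
  also have "\<dots> = U ` K"
  proof -
    have "U \<phi> - \<phi> \<in> H0 S \<longleftrightarrow> \<phi> - U \<phi> \<in> H0 S" for \<phi>
      using csubspaceD(5)[OF csubspace_H0, of "U \<phi> - \<phi>"]
        csubspaceD(5)[OF csubspace_H0, of "\<phi> - U \<phi>"] by auto
    then show ?thesis unfolding K_eq by blast
  qed
  finally show ?thesis .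
qed

lemma K_D: "\<phi> \<in> K \<Longrightarrow> \<phi> \<in> NN S \<i>" "\<phi> \<in> K \<Longrightarrow> \<phi> - U \<phi> \<in> H0 S"
  by (simp_all add: K_eq)

lemma csubspace_K: "csubspace K"
proof (rule complex_vector.subspaceI)
  show "0 \<in> K" by (simp add: K_eq U_zero csubspaceD(1) csubspace_NN csubspace_H0)
  show "x + y \<in> K" if "x \<in> K" "y \<in> K" for x y
  proof -
    have "(x - U x) + (y - U y) \<in> H0 S" using that K_D by (intro csubspaceD(2)[OF csubspace_H0])
    moreover have "x + y - U (x + y) = (x - U x) + (y - U y)"
      using that by (simp add: U_add K_D)
    moreover have "x + y \<in> NN S \<i>" using that K_D by (intro csubspaceD csubspace_NN)
    ultimately show ?thesis unfolding K_eq mem_Collect_eq by metis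
  qed
  show "c *\<^sub>C x \<in> K" if "x \<in> K" for c x
  proof -
    have "c *\<^sub>C (x - U x) \<in> H0 S" using that K_D by (intro csubspaceD(4)[OF csubspace_H0])
    moreover have "c *\<^sub>C x - U (c *\<^sub>C x) = c *\<^sub>C (x - U x)"
      using that by (simp add: U_scale K_D complex_vector.scale_right_diff_distrib)
    moreover have "c *\<^sub>C x \<in> NN S \<i>" using that K_D by (intro csubspaceD csubspace_NN)
    ultimately show ?thesis unfolding K_eq mem_Collect_eq by metis
  qed
qed

text \<open>A vector \<^term>\<open>\<phi>\<close> with \<^term>\<open>\<phi> - U \<phi> \<in> Domain S\<close> lies in \<^term>\<open>LL_at S \<i>\<close> and there
  \<^term>\<open>U\<close> agrees with \<^term>\<open>VV S \<i>\<close>, so this is admissibility.\<close>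

lemma diff_U_in_Domain_imp_0:
  assumes \<phi>: "\<phi> \<in> NN S \<i>" "\<phi> - U \<phi> \<in> Domain S"
  shows "\<phi> = 0"
proof -
  obtain h where h: "h \<in> LL S" "\<phi> = proj (NN S \<i>) h" "U \<phi> = proj (NN S (- \<i>)) h"
    by (rule diff_in_Domain_imp_proj[OF disjI1[OF refl] \<phi>(1) U_in[OF \<phi>(1)] \<phi>(2)])
  have "VV S \<i> \<phi> = U \<phi>" using VV_proj_NN[OF _ h(1), of \<i>] h by simp
  moreover have "\<phi> \<in> LL_at S \<i>" using h by (auto simp: LL_at_def)
  ultimately show ?thesis using admissible unfolding admissible_def by (auto simp: Ball_def)
qed

lemmas K_split_norm = ker_at_split[OF disjI1[OF refl] equalityD1[OF U_image]]

lemma K_split: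
  assumes "\<phi> \<in> K"
  obtains f g where "(f, g) \<in> S" "\<phi> - U \<phi> = f + P \<phi> - Q (U \<phi>)"
    "proj (H0 S) (\<i> *\<^sub>C \<phi> + \<i> *\<^sub>C U \<phi>) = proj (H0 S) g + \<i> *\<^sub>C P \<phi> + \<i> *\<^sub>C Q (U \<phi>)"
  by (rule K_split_norm[OF assms])

text \<open>Pythagoras: \<open>U\<close> preserves the norm, and the \<open>LL_at\<close> parts of
  \<open>\<phi>\<close> and \<open>U \<phi>\<close> have equal norms.\<close>

lemma norm_P_K:
  assumes "\<phi> \<in> K"
  shows "norm (P \<phi>) = norm (Q (U \<phi>))"
proof -
  obtain f g where "norm (proj (LL_at S \<i>) \<phi>) = norm (proj (LL_at S (- \<i>)) (U \<phi>))"
    by (rule K_split_norm[OF assms])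
  moreover have "(norm (U \<phi>))\<^sup>2 = (norm (Q (U \<phi>)))\<^sup>2 + (norm (proj (LL_at S (- \<i>)) (U \<phi>)))\<^sup>2"
    by (rule norm_NN_decompose) (simp_all add: U_in K_D assms)
  moreover have "(norm \<phi>)\<^sup>2 = (norm (P \<phi>))\<^sup>2 + (norm (proj (LL_at S \<i>) \<phi>))\<^sup>2"
    by (rule norm_NN_decompose) (simp_all add: K_D assms)
  ultimately have "(norm (P \<phi>))\<^sup>2 = (norm (Q (U \<phi>)))\<^sup>2"
    using norm_U[OF K_D(1)[OF assms]] by simp
  then show ?thesis by simp
qed

text \<open>If one projection vanishes, so does the other; then \<open>\<phi> - U \<phi>\<close> is
  in \<open>Domain S\<close> and admissibility applies.\<close>

lemma P_K_eq_0_iff: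
  assumes "\<phi> \<in> K"
  shows "P \<phi> = 0 \<longleftrightarrow> \<phi> = 0" "Q (U \<phi>) = 0 \<longleftrightarrow> \<phi> = 0"
proof -
  obtain f g where fg: "(f, g) \<in> S" "\<phi> - U \<phi> = f + P \<phi> - Q (U \<phi>)" by (rule K_split[OF assms])
  have iff: "P \<phi> = 0 \<longleftrightarrow> Q (U \<phi>) = 0" using norm_P_K[OF assms] by (metis norm_eq_zero)
  have "\<phi> = 0" if "P \<phi> = 0"
    using fg that iff diff_U_in_Domain_imp_0[OF K_D(1)[OF assms]] by auto
  then show "P \<phi> = 0 \<longleftrightarrow> \<phi> = 0" "Q (U \<phi>) = 0 \<longleftrightarrow> \<phi> = 0"
    using iff by (auto simp: U_zero proj_zero closed_csubspace_NN')
qed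

text \<open>As a relation the map requires no inverse of \<open>P\<close>; linearity and
  \<open>norm_P_K\<close> make it well defined and injective.\<close>

definition A :: "'a graph" where "A = {(P \<phi>, Q (U \<phi>)) | \<phi>. \<phi> \<in> K}"

lemma Domain_A: "Domain A = P ` K" and Range_A: "Range A = Q ` K'"
  unfolding A_def K'_eq by auto

sublocale S0: isometric_extension S0 "H0 S" A
proof unfold_locales
  show "csubspace A"
  proof (rule complex_vector.subspaceI)
    show "0 \<in> A" unfolding A_def zero_prod_def
      using csubspaceD(1)[OF csubspace_K] by (force simp: U_zero proj_zero closed_csubspace_NN')
  next
    fix p q assume "p \<in> A" "q \<in> A"
    then obtain \<phi> \<psi> where *: "\<phi> \<in> K" "p = (P \<phi>, Q (U \<phi>))" "\<psi> \<in> K" "q = (P \<psi>, Q (U \<psi>))"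
      unfolding A_def by blast
    then have "p + q = (P (\<phi> + \<psi>), Q (U (\<phi> + \<psi>)))"
      by (simp add: proj_add closed_csubspace_NN' U_add K_D)
    moreover have "\<phi> + \<psi> \<in> K" using * by (intro csubspaceD csubspace_K)
    ultimately show "p + q \<in> A" unfolding A_def by blast
  next
    fix c p assume "p \<in> A"
    then obtain \<phi> where *: "\<phi> \<in> K" "p = (P \<phi>, Q (U \<phi>))" unfolding A_def by blast
    then have "c *\<^sub>C p = (P (c *\<^sub>C \<phi>), Q (U (c *\<^sub>C \<phi>)))"
      by (simp add: proj_scaleC closed_csubspace_NN' U_scale K_D scaleC_prod_def)
    moreover have "c *\<^sub>C \<phi> \<in> K" using * by (intro csubspaceD csubspace_K)
    ultimately show "c *\<^sub>C p \<in> A" unfolding A_def by blast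
  qed
  show "A \<subseteq> deficiency_subspace (H0 S) S0 \<i> \<times> deficiency_subspace (H0 S) S0 (- \<i>)"
    unfolding NN'_eq_deficiency[symmetric] A_def using proj_in[OF closed_csubspace_NN'] by auto
  show "norm \<alpha> = norm \<beta>" if "(\<alpha>, \<beta>) \<in> A" for \<alpha> \<beta>
    using that norm_P_K by (auto simp: A_def)
qed

text \<open>\<open>K_split\<close> trades \<open>\<phi>\<close> and \<open>U \<phi>\<close> for
  \<open>P \<phi>\<close> and \<open>Q (U \<phi>)\<close> at the cost of a pair
  \<open>(d, e)\<close> of \<open>S\<close>, added to \<open>(f, g)\<close> in one direction and
  subtracted in the other.\<close>

lemma compression_extension: "compression (H0 S) (extension S U) = vn_extension S0 A"
proof
  show "compression (H0 S) (extension S U) \<subseteq> vn_extension S0 A"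
  proof safe
    fix u w assume "(u, w) \<in> compression (H0 S) (extension S U)"
    then obtain f g \<phi> where 1: "(f, g) \<in> S" "\<phi> \<in> NN S \<i>" "u = f + \<phi> - U \<phi>" "u \<in> H0 S"
      "w = proj (H0 S) (g + \<i> *\<^sub>C \<phi> + \<i> *\<^sub>C U \<phi>)"
      unfolding compression_def extension_def by blast
    have "u - f \<in> H0 S" using 1(4) in_H0[OF 1(1)] by (intro csubspaceD csubspace_H0)
    then have \<phi>: "\<phi> \<in> K" using 1(2,3) by (simp add: K_eq)
    obtain d e where de: "(d, e) \<in> S" "\<phi> - U \<phi> = d + P \<phi> - Q (U \<phi>)"
      "proj (H0 S) (\<i> *\<^sub>C \<phi> + \<i> *\<^sub>C U \<phi>) = proj (H0 S) e + \<i> *\<^sub>C P \<phi> + \<i> *\<^sub>C Q (U \<phi>)"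
      by (rule K_split[OF \<phi>])
    show "(u, w) \<in> vn_extension S0 A"
    proof (rule S0.vn_extensionI)
      show "(f + d, proj (H0 S) (g + e)) \<in> S0" using T_add[OF 1(1) de(1)] by (auto simp: S0_eq)
      show "(P \<phi>, Q (U \<phi>)) \<in> A" using \<phi> by (auto simp: A_def)
      have "u = f + (\<phi> - U \<phi>)" by (simp add: 1(3))
      then show "u = f + d + P \<phi> - Q (U \<phi>)" unfolding de(2) by (simp add: add.assoc)
      have "w = proj (H0 S) g + proj (H0 S) (\<i> *\<^sub>C \<phi> + \<i> *\<^sub>C U \<phi>)"
        unfolding 1(5) by (simp add: proj_add closed_csubspace_H0)
      then show "w = proj (H0 S) (g + e) + \<i> *\<^sub>C P \<phi> + \<i> *\<^sub>C Q (U \<phi>)"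
        unfolding de(3) by (simp add: proj_add closed_csubspace_H0)
    qed
  qed
  show "vn_extension S0 A \<subseteq> compression (H0 S) (extension S U)"
  proof safe
    fix u w assume uw: "(u, w) \<in> vn_extension S0 A"
    then obtain f g \<phi> where 1: "(f, g) \<in> S" "\<phi> \<in> K" "u = f + P \<phi> - Q (U \<phi>)"
      "w = proj (H0 S) g + \<i> *\<^sub>C P \<phi> + \<i> *\<^sub>C Q (U \<phi>)"
      unfolding vn_extension_def S0_eq A_def by blast
    obtain d e where de: "(d, e) \<in> S" "\<phi> - U \<phi> = d + P \<phi> - Q (U \<phi>)"
      "proj (H0 S) (\<i> *\<^sub>C \<phi> + \<i> *\<^sub>C U \<phi>) = proj (H0 S) e + \<i> *\<^sub>C P \<phi> + \<i> *\<^sub>C Q (U \<phi>)"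
      by (rule K_split[OF 1(2)])
    have "u = (f - d) + (\<phi> - U \<phi>)" unfolding de(2) 1(3) by simp
    then have u: "u = (f - d) + \<phi> - U \<phi>" by simp
    have "w = proj (H0 S) (g - e) + proj (H0 S) (\<i> *\<^sub>C \<phi> + \<i> *\<^sub>C U \<phi>)"
      unfolding de(3) 1(4) by (simp add: proj_diff closed_csubspace_H0)
    then have w: "w = proj (H0 S) ((g - e) + \<i> *\<^sub>C \<phi> + \<i> *\<^sub>C U \<phi>)"
      by (simp add: proj_add closed_csubspace_H0)
    have "(u, (g - e) + \<i> *\<^sub>C \<phi> + \<i> *\<^sub>C U \<phi>) \<in> extension S U"
      unfolding extension_def u using T_diff[OF 1(1) de(1)] K_D(1)[OF 1(2)] by blast
    moreover have "u \<in> H0 S" using uw S0.vn_extension_sub by auto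
    ultimately show "(u, w) \<in> compression (H0 S) (extension S U)"
      unfolding compression_def w by blast
  qed
qed

text \<open>A linear \<open>G\<close> congruent to \<open>\<phi> - U \<phi>\<close> modulo
  \<open>Domain S\<close> yields the same sum, and \<open>G \<phi> \<in> Domain S\<close> would put
  \<open>\<phi> - U \<phi>\<close> into \<open>Domain S\<close>, which admissibility allows only for
  \<open>\<phi> = 0\<close>.\<close>

lemma is_direct_sum_image:
  assumes add: "\<And>x y. x \<in> K \<Longrightarrow> y \<in> K \<Longrightarrow> G (x + y) = G x + G y"
    and scale: "\<And>c x. x \<in> K \<Longrightarrow> G (c *\<^sub>C x) = c *\<^sub>C G x"
    and mod: "\<And>\<phi>. \<phi> \<in> K \<Longrightarrow> \<phi> - U \<phi> - G \<phi> \<in> Domain S"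
  shows "is_direct_sum (Domain (extension S U) \<inter> H0 S) (Domain S) (G ` K)"
proof -
  note K0 = csubspaceD[OF csubspace_K] and D = csubspaceD[OF csubspace_Domain]
  have G0: "G 0 = 0" using scale[OF K0(1), of 0] by simp
  have sub: "csubspace (G ` K)"
  proof (rule complex_vector.subspaceI)
    show "0 \<in> G ` K" using K0(1) G0 by force
    show "x + y \<in> G ` K" if "x \<in> G ` K" "y \<in> G ` K" for x y
      using that by (auto simp: add[symmetric] K0)
    show "c *\<^sub>C x \<in> G ` K" if "x \<in> G ` K" for c x
      using that by (auto simp: scale[symmetric] K0)
  qed
  have int: "Domain S \<inter> G ` K = {0}"
  proof -
    have "G \<phi> = 0" if "\<phi> \<in> K" "G \<phi> \<in> Domain S" for \<phi>
    proof -
      have "(\<phi> - U \<phi> - G \<phi>) + G \<phi> \<in> Domain S" using that mod by (intro D(2))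
      then have "\<phi> = 0" using diff_U_in_Domain_imp_0 K_D(1)[OF that(1)] by simp
      then show ?thesis using G0 by simp
    qed
    then show ?thesis using D(1) csubspaceD(1)[OF sub] by blast
  qed
  have "Domain (extension S U) = {f + \<phi> - U \<phi> | f \<phi>. f \<in> Domain S \<and> \<phi> \<in> NN S \<i>}"
    unfolding extension_def by blast
  then have "Domain (extension S U) \<inter> H0 S = {f + \<phi> - U \<phi> | f \<phi>. f \<in> Domain S \<and> \<phi> \<in> K}"
  proof -
    have "f + \<phi> - U \<phi> \<in> H0 S \<longleftrightarrow> \<phi> - U \<phi> \<in> H0 S" if "f \<in> Domain S" for f \<phi>
      using csubspaceD(3)[OF csubspace_H0, of "f + \<phi> - U \<phi>" f]
        csubspaceD(2)[OF csubspace_H0, of f "\<phi> - U \<phi>"] Domain_subset_H0 that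
      by (auto simp: algebra_simps)
    then show ?thesis unfolding \<open>Domain (extension S U) = _\<close> K_eq by blast
  qed
  also have "\<dots> = {a + b | a b. a \<in> Domain S \<and> b \<in> G ` K}"
  proof
    show "{f + \<phi> - U \<phi> | f \<phi>. f \<in> Domain S \<and> \<phi> \<in> K} \<subseteq> {a + b | a b. a \<in> Domain S \<and> b \<in> G ` K}"
    proof
      fix x assume "x \<in> {f + \<phi> - U \<phi> | f \<phi>. f \<in> Domain S \<and> \<phi> \<in> K}"
      then obtain f \<phi> where *: "f \<in> Domain S" "\<phi> \<in> K" "x = f + \<phi> - U \<phi>" by blast
      have "x = (f + (\<phi> - U \<phi> - G \<phi>)) + G \<phi>" by (simp add: *(3))
      then show "x \<in> {a + b | a b. a \<in> Domain S \<and> b \<in> G ` K}"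
        using D(2)[OF *(1) mod[OF *(2)]] *(2) by blast
    qed
    show "{a + b | a b. a \<in> Domain S \<and> b \<in> G ` K} \<subseteq> {f + \<phi> - U \<phi> | f \<phi>. f \<in> Domain S \<and> \<phi> \<in> K}"
    proof
      fix x assume "x \<in> {a + b | a b. a \<in> Domain S \<and> b \<in> G ` K}"
      then obtain f \<phi> where *: "f \<in> Domain S" "\<phi> \<in> K" "x = f + G \<phi>" by blast
      have "x = (f - (\<phi> - U \<phi> - G \<phi>)) + \<phi> - U \<phi>" by (simp add: *(3))
      then show "x \<in> {f + \<phi> - U \<phi> | f \<phi>. f \<in> Domain S \<and> \<phi> \<in> K}"
        using D(3)[OF *(1) mod[OF *(2)]] *(2) by blast
    qed
  qed
  finally show ?thesis
    unfolding is_direct_sum_def using sub int csubspace_Domain by blast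
qed

text \<open>The formulas with \<open>U_inv S U\<close> produce the negatives of those with
  \<open>U\<close>, and a subspace does not see the sign.\<close>

lemma image_uminus_K:
  assumes "\<And>x. x \<in> K \<Longrightarrow> G (- x) = - G x"
  shows "(\<lambda>x. - G x) ` K = G ` K"
proof -
  have "(\<lambda>x. - G x) ` K = G ` uminus ` K"
    unfolding image_image using assms by (intro image_cong) auto
  also have "uminus ` K = K"
    using csubspaceD(5)[OF csubspace_K] by (force intro: image_eqI[of _ uminus "- x" for x])
  finally show ?thesis .
qed

lemma direct_sum_decompositions:
  "is_direct_sum (Domain (extension S U) \<inter> H0 S) (Domain S) ((\<lambda>\<phi>. \<phi> - U \<phi>) ` K)"
  "is_direct_sum (Domain (extension S U) \<inter> H0 S) (Domain S) ((\<lambda>\<psi>. \<psi> - U_inv S U \<psi>) ` K')"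
  "is_direct_sum (Domain (extension S U) \<inter> H0 S) (Domain S) ((\<lambda>\<phi>. P \<phi> - Q (U \<phi>)) ` K)"
  "is_direct_sum (Domain (extension S U) \<inter> H0 S) (Domain S)
    ((\<lambda>\<psi>. Q \<psi> - P (U_inv S U \<psi>)) ` K')"
proof -
  show 1: "is_direct_sum (Domain (extension S U) \<inter> H0 S) (Domain S) ((\<lambda>\<phi>. \<phi> - U \<phi>) ` K)"
    by (rule is_direct_sum_image)
      (simp_all add: U_add U_scale K_D complex_vector.scale_right_diff_distrib
        csubspaceD(1)[OF csubspace_Domain])
  have "(\<lambda>\<psi>. \<psi> - U_inv S U \<psi>) ` K' = (\<lambda>\<phi>. - (\<phi> - U \<phi>)) ` K"
    unfolding K'_eq image_image by (intro image_cong) (simp_all add: U_inv_U K_D)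
  also have "\<dots> = (\<lambda>\<phi>. \<phi> - U \<phi>) ` K"
    by (rule image_uminus_K) (simp add: U_minus K_D)
  finally show "is_direct_sum (Domain (extension S U) \<inter> H0 S) (Domain S)
      ((\<lambda>\<psi>. \<psi> - U_inv S U \<psi>) ` K')" using 1 by simp
  show 2: "is_direct_sum (Domain (extension S U) \<inter> H0 S) (Domain S) ((\<lambda>\<phi>. P \<phi> - Q (U \<phi>)) ` K)"
  proof (rule is_direct_sum_image)
    fix \<phi> assume "\<phi> \<in> K"
    then obtain f g where "(f, g) \<in> S" "\<phi> - U \<phi> = f + P \<phi> - Q (U \<phi>)" by (rule K_split)
    then show "\<phi> - U \<phi> - (P \<phi> - Q (U \<phi>)) \<in> Domain S" by auto
  qed (simp_all add: U_add U_scale K_D complex_vector.scale_right_diff_distrib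
      proj_add proj_scaleC closed_csubspace_NN')
  have "(\<lambda>\<psi>. Q \<psi> - P (U_inv S U \<psi>)) ` K' = (\<lambda>\<phi>. - (P \<phi> - Q (U \<phi>))) ` K"
    unfolding K'_eq image_image by (intro image_cong) (simp_all add: U_inv_U K_D)
  also have "\<dots> = (\<lambda>\<phi>. P \<phi> - Q (U \<phi>)) ` K"
    by (rule image_uminus_K) (simp add: U_minus K_D proj_minus closed_csubspace_NN')
  finally show "is_direct_sum (Domain (extension S U) \<inter> H0 S) (Domain S)
      ((\<lambda>\<psi>. Q \<psi> - P (U_inv S U \<psi>)) ` K')" using 2 by simp
qed

section \<open>Triviality criteria\<close>

lemma image_K_trivial_iff:
  assumes "\<And>\<phi>. \<phi> \<in> K \<Longrightarrow> F \<phi> = (0 :: 'a) \<longleftrightarrow> \<phi> = 0"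
  shows "F ` K = {0} \<longleftrightarrow> K = {0}"
proof
  assume F: "F ` K = {0}"
  have "x = 0" if "x \<in> K" for x
    using assms[OF that] imageI[OF that, of F] unfolding F by simp
  then show "K = {0}" using csubspaceD(1)[OF csubspace_K] by blast
next
  assume K: "K = {0}"
  have "F 0 = 0" using assms[of 0] csubspaceD(1)[OF csubspace_K] by simp
  then show "F ` K = {0}" unfolding K by simp
qed

text \<open>By the first decomposition, equality means that \<open>\<phi> - U \<phi>\<close>
  vanishes on the kernel, and by admissibility it does so only at zero.\<close>

lemma Domain_eq_iff: "Domain (extension S U) \<inter> H0 S = Domain S \<longleftrightarrow> K = {0}"
proof -
  have *: "W = D \<longleftrightarrow> B = {0}" if "is_direct_sum W D B" for W D B :: "'a set"
  proof
    assume "W = D"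
    moreover have "B \<subseteq> W"
    proof
      fix b assume "b \<in> B"
      moreover have "0 \<in> D" using that csubspaceD(1) unfolding is_direct_sum_def by blast
      ultimately have "0 + b \<in> W" using that unfolding is_direct_sum_def by blast
      then show "b \<in> W" by simp
    qed
    ultimately show "B = {0}" using that unfolding is_direct_sum_def by blast
  next
    assume "B = {0}"
    then show "W = D" using that unfolding is_direct_sum_def by auto
  qed
  have "\<phi> - U \<phi> = 0 \<longleftrightarrow> \<phi> = 0" if "\<phi> \<in> K" for \<phi>
    using diff_U_in_Domain_imp_0[OF K_D(1)[OF that]] csubspaceD(1)[OF csubspace_Domain]
    by (metis U_zero diff_zero)
  then have "(\<lambda>\<phi>. \<phi> - U \<phi>) ` K = {0} \<longleftrightarrow> K = {0}"
    by (rule image_K_trivial_iff)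
  then show ?thesis using *[OF direct_sum_decompositions(1)] by simp
qed

lemma K_trivial_iff:
  "P ` K = {0} \<longleftrightarrow> K = {0}" "K' = {0} \<longleftrightarrow> K = {0}" "Q ` K' = {0} \<longleftrightarrow> K = {0}"
proof -
  show "P ` K = {0} \<longleftrightarrow> K = {0}" by (rule image_K_trivial_iff) (rule P_K_eq_0_iff)
  have "U \<phi> = 0 \<longleftrightarrow> \<phi> = 0" if "\<phi> \<in> K" for \<phi> using norm_U[OF K_D(1)[OF that]] by auto
  then show "K' = {0} \<longleftrightarrow> K = {0}" unfolding K'_eq by (rule image_K_trivial_iff)
  show "Q ` K' = {0} \<longleftrightarrow> K = {0}"
    unfolding K'_eq image_image by (rule image_K_trivial_iff) (rule P_K_eq_0_iff)
qed

text \<open>Triviality at \<open>\<mu>\<close> passes to \<open>\<i>\<close> or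
  \<open>- \<i>\<close> in the same half-plane, where \<open>P\<close> or \<open>Q\<close> then
  annihilates its kernel although it vanishes there only at zero.\<close>

lemma K_trivial_if:
  assumes "Im \<mu> \<noteq> 0" "NN' S \<mu> = {0}"
  shows "K = {0}"
proof (cases "Im \<mu> > 0")
  case True
  then have "NN' S \<i> = {0}"
    using S0.deficiency_subspace_trivial[OF S0.closed_T, of \<mu> \<i>] assms(2)
    by (simp add: NN'_eq_deficiency)
  then have "P ` K \<subseteq> {0}" using proj_in[OF closed_csubspace_NN', of \<i>] by auto
  then show ?thesis using K_trivial_iff(1) csubspaceD(1)[OF csubspace_K] by auto
next
  case False
  then have "NN' S (- \<i>) = {0}"
    using S0.deficiency_subspace_trivial[OF S0.closed_T, of \<mu> "- \<i>"] assms
    by (simp add: NN'_eq_deficiency)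
  then have "Q ` K' \<subseteq> {0}" using proj_in[OF closed_csubspace_NN', of "- \<i>"] by auto
  moreover have "K' \<noteq> {}" using csubspaceD(1)[OF csubspace_K] by (auto simp: K'_eq)
  ultimately show ?thesis using K_trivial_iff(3) by auto
qed

end

theorem proposition5p1:
  fixes S :: "'a :: complex_hilbert graph" and U U' :: "'a \<Rightarrow> 'a"
    and St St0 :: "'a graph" and K K' :: "'a set"
  assumes "separable TYPE('a)" and "hdim (UNIV :: 'a set) = \<infinity>"
    and "regular_symmetric S" and "H0 S \<noteq> UNIV" and "n_plus S = n_minus S"
    and "admissible S U"
  defines "St \<equiv> extension S U"
    and "St0 \<equiv> compression (H0 S) St"
    and "U' \<equiv> U_inv S U"
    and "K \<equiv> ker_at S \<i> U"
    and "K' \<equiv> ker_at S (-\<i>) U'"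
  shows
    "(is_direct_sum (Domain St \<inter> H0 S) (Domain S) ((\<lambda>\<phi>. \<phi> - U \<phi>) ` K) \<and>
      is_direct_sum (Domain St \<inter> H0 S) (Domain S) ((\<lambda>\<psi>. \<psi> - U' \<psi>) ` K') \<and>
      is_direct_sum (Domain St \<inter> H0 S) (Domain S)
        ((\<lambda>\<phi>. proj (NN' S \<i>) \<phi> - proj (NN' S (-\<i>)) (U \<phi>)) ` K) \<and>
      is_direct_sum (Domain St \<inter> H0 S) (Domain S)
        ((\<lambda>\<psi>. proj (NN' S (-\<i>)) \<psi> - proj (NN' S \<i>) (U' \<psi>)) ` K')) \<and>

     (deficiency_subspace (H0 S) St0 \<i> = NN' S \<i> \<ominus> proj (NN' S \<i>) ` K \<and>
      deficiency_subspace (H0 S) St0 (-\<i>) = NN' S (-\<i>) \<ominus> proj (NN' S (-\<i>)) ` K') \<and>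

     ((closed_operator St0 \<longleftrightarrow> closed_csubspace (proj (NN' S \<i>) ` K)) \<and>
      (closed_operator St0 \<longleftrightarrow> closed_csubspace (proj (NN' S (-\<i>)) ` K'))) \<and>

     ((Domain St \<inter> H0 S = Domain S \<longleftrightarrow> K = {0}) \<and>
      (Domain St \<inter> H0 S = Domain S \<longleftrightarrow> proj (NN' S \<i>) ` K = {0}) \<and>
      (Domain St \<inter> H0 S = Domain S \<longleftrightarrow> K' = {0}) \<and>
      (Domain St \<inter> H0 S = Domain S \<longleftrightarrow> proj (NN' S (-\<i>)) ` K' = {0}) \<and>
      ((\<exists>\<mu>. Im \<mu> \<noteq> 0 \<and> NN' S \<mu> = {0}) \<longrightarrow> Domain St \<inter> H0 S = Domain S)) \<and>

     (n'_plus S = n'_minus S \<and> n'_plus S \<noteq> 0 \<longrightarrow>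
      (selfadjoint_in (H0 S) St0 \<longleftrightarrow>
         proj (NN' S \<i>) ` K = NN' S \<i> \<and>
         (\<lambda>\<phi>. proj (NN' S (-\<i>)) (U \<phi>)) ` K = NN' S (-\<i>)) \<and>
      (selfadjoint_in (H0 S) St0 \<longleftrightarrow>
         proj (NN' S (-\<i>)) ` K' = NN' S (-\<i>) \<and>
         (\<lambda>\<psi>. proj (NN' S \<i>) (U' \<psi>)) ` K' = NN' S \<i>) \<and>
      (selfadjoint_in (H0 S) St0 \<longleftrightarrow>
         proj (NN' S \<i>) ` K = NN' S \<i> \<and>
         proj (NN' S (-\<i>)) ` K' = NN' S (-\<i>)))"
proof -
  interpret admissible_extension S U
    using assms(3,6) by unfold_locales
  \<comment> \<open>Since \<open>K'\<close> is the image of \<open>K\<close> under \<open>U\<close>,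
    these images are the two projected kernels again, and the three conditions for selfadjointness
    coincide up to order.\<close>
  have imgs: "(\<lambda>\<phi>. proj (NN' S (- \<i>)) (U \<phi>)) ` K = proj (NN' S (- \<i>)) ` K'"
    "(\<lambda>\<psi>. proj (NN' S \<i>) (U' \<psi>)) ` K' = proj (NN' S \<i>) ` K"
    unfolding K_def K'_def U'_def K'_eq image_image
    by (simp, intro image_cong, simp_all add: U_inv_U K_D)
  have St0: "St0 = vn_extension S0 A"
    unfolding St0_def St_def by (rule compression_extension)
  have 1: "is_direct_sum (Domain St \<inter> H0 S) (Domain S) ((\<lambda>\<phi>. \<phi> - U \<phi>) ` K) \<and>
      is_direct_sum (Domain St \<inter> H0 S) (Domain S) ((\<lambda>\<psi>. \<psi> - U' \<psi>) ` K') \<and>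
      is_direct_sum (Domain St \<inter> H0 S) (Domain S)
        ((\<lambda>\<phi>. proj (NN' S \<i>) \<phi> - proj (NN' S (-\<i>)) (U \<phi>)) ` K) \<and>
      is_direct_sum (Domain St \<inter> H0 S) (Domain S)
        ((\<lambda>\<psi>. proj (NN' S (-\<i>)) \<psi> - proj (NN' S \<i>) (U' \<psi>)) ` K')"
    unfolding St_def K_def K'_def U'_def by (intro conjI direct_sum_decompositions)
  have 2: "deficiency_subspace (H0 S) St0 \<i> = NN' S \<i> \<ominus> proj (NN' S \<i>) ` K \<and>
      deficiency_subspace (H0 S) St0 (-\<i>) = NN' S (-\<i>) \<ominus> proj (NN' S (-\<i>)) ` K'"
    unfolding St0 S0.deficiency_vn_extension Domain_A Range_A NN'_eq_deficiency[symmetric]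
      K_def K'_def U'_def by simp
  have 3: "(closed_operator St0 \<longleftrightarrow> closed_csubspace (proj (NN' S \<i>) ` K)) \<and>
      (closed_operator St0 \<longleftrightarrow> closed_csubspace (proj (NN' S (-\<i>)) ` K'))"
    unfolding St0 K_def K'_def U'_def Domain_A[symmetric] Range_A[symmetric]
    by (intro conjI S0.closed_vn_extension_iff)
  have 4: "(Domain St \<inter> H0 S = Domain S \<longleftrightarrow> K = {0}) \<and>
      (Domain St \<inter> H0 S = Domain S \<longleftrightarrow> proj (NN' S \<i>) ` K = {0}) \<and>
      (Domain St \<inter> H0 S = Domain S \<longleftrightarrow> K' = {0}) \<and>
      (Domain St \<inter> H0 S = Domain S \<longleftrightarrow> proj (NN' S (-\<i>)) ` K' = {0}) \<and>
      ((\<exists>\<mu>. Im \<mu> \<noteq> 0 \<and> NN' S \<mu> = {0}) \<longrightarrow> Domain St \<inter> H0 S = Domain S)"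
    unfolding St_def K_def K'_def U'_def Domain_eq_iff K_trivial_iff
    using K_trivial_if by blast
  have 5: "selfadjoint_in (H0 S) St0 \<longleftrightarrow>
      proj (NN' S \<i>) ` K = NN' S \<i> \<and> proj (NN' S (-\<i>)) ` K' = NN' S (-\<i>)"
    unfolding St0 S0.selfadjoint_vn_extension_iff Domain_A Range_A NN'_eq_deficiency[symmetric]
      K_def K'_def U'_def ..
  show ?thesis
    by (rule conjI[OF 1 conjI[OF 2 conjI[OF 3 conjI[OF 4 impI]]]],
        unfold imgs 5) (simp only: conj_commute simp_thms)
qed

end
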